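(* Let $(\mathfrak g,[\cdot,\cdot]_{\mathfrak g})$ and $(\mathfrak h,[\cdot,\cdot]_{\mathfrak h})$ be Leibniz algebras. Then non-abelian extensions of $\mathfrak g$ by $\mathfrak h$ are classified by the second non-abelian cohomology $H^2(\mathfrak g,\mathfrak h)$: assigning to an extension $\hat{\mathfrak g}$ the class of the non-abelian 2-cocycle $(l,r,\omega)$ associated to a splitting of $\hat{\mathfrak g}$ gives a well-defined one-to-one correspondence between isomorphism classes of non-abelian extensions of $\mathfrak g$ by $\mathfrak h$ and elements of $H^2(\mathfrak g,\mathfrak h)$.
   Context: All vector spaces are over a fixed ground field. A (left) Leibniz algebra is a vector space $\mathfrak g$ with a bilinear bracket satisfying $[x,[y,z]_{\mathfrak g}]_{\mathfrak g}=[[x,y]_{\mathfrak g},z]_{\mathfrak g}+[y,[x,z]_{\mathfrak g}]_{\mathfrak g}$ for all $x,y,z$. For $x\in\mathfrak g$, $\mathrm{ad}^L_x(y)=[x,y]_{\mathfrak g}$ and $\mathrm{ad}^R_x(y)=[y,x]_{\mathfrak g}$. Left derivations: $\mathrm{Der}^L(\mathfrak h)=\{D\in\mathfrak{gl}(\mathfrak h): D[\alpha,\beta]_{\mathfrak h}=[D\alpha,\beta]_{\mathfrak h}+[\alpha,D\beta]_{\mathfrak h}\ \forall\alpha,\beta\}$. Right derivations: $\mathrm{Der}^R(\mathfrak h)=\{D\in\mathfrak{gl}(\mathfrak h): D[\alpha,\beta]_{\mathfrak h}=[\alpha,D\beta]_{\mathfrak h}-[\beta,D\alpha]_{\mathfrak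 h}\ \forall\alpha,\beta\}$. For $D_1,D_2\in\mathfrak{gl}(\mathfrak h)$, $[D_1,D_2]=D_1D_2-D_2D_1$. A non-abelian extension of $\mathfrak g$ by $\mathfrak h$ is a short exact sequence of Leibniz algebras $0\to\mathfrak h\xrightarrow{i}\hat{\mathfrak g}\xrightarrow{p}\mathfrak g\to0$ ($\mathfrak h$ is identified with $i(\mathfrak h)$). A splitting is a linear map $\sigma:\mathfrak g\to\hat{\mathfrak g}$ with $p\circ\sigma=\mathrm{id}$. Two extensions $\hat{\mathfrak g}_1,\hat{\mathfrak g}_2$ (with maps $i_j,p_j$) are isomorphic if there is a Leibniz algebra morphism $\theta:\hat{\mathfrak g}_2\to\hat{\mathfrak g}_1$ with $\theta\circ i_2=i_1$ and $p_1\circ\theta=p_2$. A non-abelian 2-cocycle on $\mathfrak g$ with values in $\mathfrak h$ is a triple $(l,r,\omega)$ of linear maps $l:\mathfrak g\to\mathrm{Der}^L(\mathfrak h)$, $r:\mathfrak g\to\mathrm{Der}^R(\mathfrak h)$, $\omega:\mathfrak g\otimes\mathfrak g\to\mathfrak h$ such that for all $x,y,z\in\mathfrak g$, $\alpha,\beta\in\mathfrak h$: $[l_x\alpha+r_x\alpha,\beta]_{\mathfrak h}=0$; $[l_x,l_y]-l_{[x,y]_{\mathfrak g}}=\mathrm{ad}^L_{\omega(x,y)}$; $[l_x,r_y]-r_{[x,y]_{\mathfrak g}}=\mathrm{ad}^R_{\omega(x,y)}$; $r_y(r_x(\alpha)+l_x(\alpha))=0$; $l_x\omega(y,z)-l_y\omega(x,z)-r_z\omega(x,y)=\omega([x,y]_{\mathfrak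 g},z)-\omega(x,[y,z]_{\mathfrak g})+\omega(y,[x,z]_{\mathfrak g})$. The set of these is $Z^2(\mathfrak g,\mathfrak h)$. Two cocycles $(l^1,r^1,\omega^1)$, $(l^2,r^2,\omega^2)$ are equivalent if there is a linear map $\varphi:\mathfrak g\to\mathfrak h$ such that for all $x,y\in\mathfrak g$: $l^1_x-l^2_x=\mathrm{ad}^L_{\varphi(x)}$, $r^1_x-r^2_x=\mathrm{ad}^R_{\varphi(x)}$, and $\omega^1(x,y)-\omega^2(x,y)=l^2_x\varphi(y)+r^2_y\varphi(x)+[\varphi(x),\varphi(y)]_{\mathfrak h}-\varphi([x,y]_{\mathfrak g})$. $H^2(\mathfrak g,\mathfrak h)$ is the quotient of $Z^2(\mathfrak g,\mathfrak h)$ by this equivalence relation. The cocycle associated to a splitting $\sigma$ of $\hat{\mathfrak g}$ is: $\omega(x,y)=[\sigma(x),\sigma(y)]_{\hat{\mathfrak g}}-\sigma[x,y]_{\mathfrak g}$, $l_x(\beta)=[\sigma(x),\beta]_{\hat{\mathfrak g}}$, $r_y(\alpha)=[\alpha,\sigma(y)]_{\hat{\mathfrak g}}$. *)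

theory Defs
  imports "HOL-Algebra.Module"
begin

text \<open>
  Vector spaces are modules (in the sense of HOL-Algebra) over a field. The fields \<open>mult\<close> and
  \<open>one\<close>, which the record \<open>module\<close> inherits from \<open>ring\<close>, play no role here, just as in the
  locale \<open>module\<close>; the bracket has a record field of its own. As usual in HOL-Algebra, maps
  between structures are constrained on the carriers only.
\<close>

record ('k, 'a) leibniz = "('k, 'a) module" +
  bracket :: "'a \<Rightarrow> 'a \<Rightarrow> 'a"  (\<open>\<lbrakk>_,/ _\<rbrakk>\<index>\<close>)

locale leibniz_algebra = field K + V?: module K L
  for K (structure) and L :: "('k, 'a, 'b) leibniz_scheme" (structure) +
  assumes bracket_closed:
      "\<lbrakk>x \<in> carrier L; y \<in> carrier L\<rbrakk> \<Longrightarrow> \<lbrakk>x, y\<rbrakk>\<^bsub>L\<^esub> \<in> carrier L"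
    and bracket_add_left:
      "\<lbrakk>x \<in> carrier L; y \<in> carrier L; z \<in> carrier L\<rbrakk> \<Longrightarrow>
       \<lbrakk>x \<oplus>\<^bsub>L\<^esub> y, z\<rbrakk>\<^bsub>L\<^esub> = \<lbrakk>x, z\<rbrakk>\<^bsub>L\<^esub> \<oplus>\<^bsub>L\<^esub> \<lbrakk>y, z\<rbrakk>\<^bsub>L\<^esub>"
    and bracket_add_right:
      "\<lbrakk>x \<in> carrier L; y \<in> carrier L; z \<in> carrier L\<rbrakk> \<Longrightarrow>
       \<lbrakk>x, y \<oplus>\<^bsub>L\<^esub> z\<rbrakk>\<^bsub>L\<^esub> = \<lbrakk>x, y\<rbrakk>\<^bsub>L\<^esub> \<oplus>\<^bsub>L\<^esub> \<lbrakk>x, z\<rbrakk>\<^bsub>L\<^esub>"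
    and bracket_smult_left:
      "\<lbrakk>a \<in> carrier K; x \<in> carrier L; y \<in> carrier L\<rbrakk> \<Longrightarrow>
       \<lbrakk>a \<odot>\<^bsub>L\<^esub> x, y\<rbrakk>\<^bsub>L\<^esub> = a \<odot>\<^bsub>L\<^esub> \<lbrakk>x, y\<rbrakk>\<^bsub>L\<^esub>"
    and bracket_smult_right:
      "\<lbrakk>a \<in> carrier K; x \<in> carrier L; y \<in> carrier L\<rbrakk> \<Longrightarrow>
       \<lbrakk>x, a \<odot>\<^bsub>L\<^esub> y\<rbrakk>\<^bsub>L\<^esub> = a \<odot>\<^bsub>L\<^esub> \<lbrakk>x, y\<rbrakk>\<^bsub>L\<^esub>"
    and leibniz_identity:
      "\<lbrakk>x \<in> carrier L; y \<in> carrier L; z \<in> carrier L\<rbrakk> \<Longrightarrow>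
       \<lbrakk>x, \<lbrakk>y, z\<rbrakk>\<^bsub>L\<^esub>\<rbrakk>\<^bsub>L\<^esub> = \<lbrakk>\<lbrakk>x, y\<rbrakk>\<^bsub>L\<^esub>, z\<rbrakk>\<^bsub>L\<^esub> \<oplus>\<^bsub>L\<^esub> \<lbrakk>y, \<lbrakk>x, z\<rbrakk>\<^bsub>L\<^esub>\<rbrakk>\<^bsub>L\<^esub>"

definition lin_maps ::
    "('k, 'm) ring_scheme \<Rightarrow> ('k, 'a, 'n) module_scheme \<Rightarrow> ('k, 'b, 'p) module_scheme
     \<Rightarrow> ('a \<Rightarrow> 'b) set" where
  "lin_maps K V W = {f \<in> carrier V \<rightarrow> carrier W.
     (\<forall>x\<in>carrier V. \<forall>y\<in>carrier V. f (x \<oplus>\<^bsub>V\<^esub> y) = f x \<oplus>\<^bsub>W\<^esub> f y) \<and>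
     (\<forall>a\<in>carrier K. \<forall>x\<in>carrier V. f (a \<odot>\<^bsub>V\<^esub> x) = a \<odot>\<^bsub>W\<^esub> f x)}"

definition leibniz_hom ::
    "('k, 'm) ring_scheme \<Rightarrow> ('k, 'a, 'n) leibniz_scheme \<Rightarrow> ('k, 'b, 'p) leibniz_scheme
     \<Rightarrow> ('a \<Rightarrow> 'b) set" where
  "leibniz_hom K L M = {f \<in> lin_maps K L M.
     \<forall>x\<in>carrier L. \<forall>y\<in>carrier L. f \<lbrakk>x, y\<rbrakk>\<^bsub>L\<^esub> = \<lbrakk>f x, f y\<rbrakk>\<^bsub>M\<^esub>}"

definition ad_left :: "('k, 'a, 'n) leibniz_scheme \<Rightarrow> 'a \<Rightarrow> 'a \<Rightarrow> 'a" where
  "ad_left L x y = \<lbrakk>x, y\<rbrakk>\<^bsub>L\<^esub>"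

definition ad_right :: "('k, 'a, 'n) leibniz_scheme \<Rightarrow> 'a \<Rightarrow> 'a \<Rightarrow> 'a" where
  "ad_right L x y = \<lbrakk>y, x\<rbrakk>\<^bsub>L\<^esub>"

definition Der_left ::
    "('k, 'm) ring_scheme \<Rightarrow> ('k, 'a, 'n) leibniz_scheme \<Rightarrow> ('a \<Rightarrow> 'a) set" where
  "Der_left K L = {D \<in> lin_maps K L L. \<forall>\<alpha>\<in>carrier L. \<forall>\<beta>\<in>carrier L.
     D \<lbrakk>\<alpha>, \<beta>\<rbrakk>\<^bsub>L\<^esub> = \<lbrakk>D \<alpha>, \<beta>\<rbrakk>\<^bsub>L\<^esub> \<oplus>\<^bsub>L\<^esub> \<lbrakk>\<alpha>, D \<beta>\<rbrakk>\<^bsub>L\<^esub>}"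

definition Der_right ::
    "('k, 'm) ring_scheme \<Rightarrow> ('k, 'a, 'n) leibniz_scheme \<Rightarrow> ('a \<Rightarrow> 'a) set" where
  "Der_right K L = {D \<in> lin_maps K L L. \<forall>\<alpha>\<in>carrier L. \<forall>\<beta>\<in>carrier L.
     D \<lbrakk>\<alpha>, \<beta>\<rbrakk>\<^bsub>L\<^esub> = \<lbrakk>\<alpha>, D \<beta>\<rbrakk>\<^bsub>L\<^esub> \<ominus>\<^bsub>L\<^esub> \<lbrakk>\<beta>, D \<alpha>\<rbrakk>\<^bsub>L\<^esub>}"

definition commutator ::
    "('k, 'a, 'n) leibniz_scheme \<Rightarrow> ('a \<Rightarrow> 'a) \<Rightarrow> ('a \<Rightarrow> 'a) \<Rightarrow> 'a \<Rightarrow> 'a" where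
  "commutator L D1 D2 \<alpha> = D1 (D2 \<alpha>) \<ominus>\<^bsub>L\<^esub> D2 (D1 \<alpha>)"

text \<open>
  Linearity of \<open>l : G \<rightarrow> gl(H)\<close>, where \<open>gl(H)\<close> carries the pointwise vector space structure, is
  linearity of \<open>x \<mapsto> l x \<alpha>\<close> for every \<open>\<alpha>\<close>. Linear maps on the tensor product \<open>G \<otimes> G\<close> are given
  as bilinear maps.
\<close>

type_synonym ('g, 'h) cochain = "('g \<Rightarrow> 'h \<Rightarrow> 'h) \<times> ('g \<Rightarrow> 'h \<Rightarrow> 'h) \<times> ('g \<Rightarrow> 'g \<Rightarrow> 'h)"

definition cocycles2 ::
    "('k, 'm) ring_scheme \<Rightarrow> ('k, 'g, 'n) leibniz_scheme \<Rightarrow> ('k, 'h, 'p) leibniz_scheme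
     \<Rightarrow> ('g, 'h) cochain set" where
  "cocycles2 K G H = {(l, r, \<omega>).
     (\<forall>x\<in>carrier G. l x \<in> Der_left K H) \<and>
     (\<forall>\<alpha>\<in>carrier H. (\<lambda>x. l x \<alpha>) \<in> lin_maps K G H) \<and>
     (\<forall>x\<in>carrier G. r x \<in> Der_right K H) \<and>
     (\<forall>\<alpha>\<in>carrier H. (\<lambda>x. r x \<alpha>) \<in> lin_maps K G H) \<and>
     (\<forall>x\<in>carrier G. (\<lambda>y. \<omega> x y) \<in> lin_maps K G H) \<and>
     (\<forall>y\<in>carrier G. (\<lambda>x. \<omega> x y) \<in> lin_maps K G H) \<and>
     (\<forall>x\<in>carrier G. \<forall>\<alpha>\<in>carrier H. \<forall>\<beta>\<in>carrier H.
        \<lbrakk>l x \<alpha> \<oplus>\<^bsub>H\<^esub> r x \<alpha>, \<beta>\<rbrakk>\<^bsub>H\<^esub> = \<zero>\<^bsub>H\<^esub>) \<and>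
     (\<forall>x\<in>carrier G. \<forall>y\<in>carrier G. \<forall>\<alpha>\<in>carrier H.
        commutator H (l x) (l y) \<alpha> \<ominus>\<^bsub>H\<^esub> l \<lbrakk>x, y\<rbrakk>\<^bsub>G\<^esub> \<alpha> = ad_left H (\<omega> x y) \<alpha>) \<and>
     (\<forall>x\<in>carrier G. \<forall>y\<in>carrier G. \<forall>\<alpha>\<in>carrier H.
        commutator H (l x) (r y) \<alpha> \<ominus>\<^bsub>H\<^esub> r \<lbrakk>x, y\<rbrakk>\<^bsub>G\<^esub> \<alpha> = ad_right H (\<omega> x y) \<alpha>) \<and>
     (\<forall>x\<in>carrier G. \<forall>y\<in>carrier G. \<forall>\<alpha>\<in>carrier H.
        r y (r x \<alpha> \<oplus>\<^bsub>H\<^esub> l x \<alpha>) = \<zero>\<^bsub>H\<^esub>) \<and>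
     (\<forall>x\<in>carrier G. \<forall>y\<in>carrier G. \<forall>z\<in>carrier G.
        l x (\<omega> y z) \<ominus>\<^bsub>H\<^esub> l y (\<omega> x z) \<ominus>\<^bsub>H\<^esub> r z (\<omega> x y) =
        \<omega> \<lbrakk>x, y\<rbrakk>\<^bsub>G\<^esub> z \<ominus>\<^bsub>H\<^esub> \<omega> x \<lbrakk>y, z\<rbrakk>\<^bsub>G\<^esub> \<oplus>\<^bsub>H\<^esub> \<omega> y \<lbrakk>x, z\<rbrakk>\<^bsub>G\<^esub>)}"

text \<open>
  Cocycles that agree on the carriers but differ as total HOL functions are identified by this
  relation (take \<open>\<phi>\<close> to be zero), so values outside the carriers do not affect the quotient.
\<close>

definition cocycle_rel ::
    "('k, 'm) ring_scheme \<Rightarrow> ('k, 'g, 'n) leibniz_scheme \<Rightarrow> ('k, 'h, 'p) leibniz_scheme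
     \<Rightarrow> (('g, 'h) cochain \<times> ('g, 'h) cochain) set" where
  "cocycle_rel K G H = {((l1, r1, \<omega>1), (l2, r2, \<omega>2)).
     (l1, r1, \<omega>1) \<in> cocycles2 K G H \<and> (l2, r2, \<omega>2) \<in> cocycles2 K G H \<and>
     (\<exists>\<phi>\<in>lin_maps K G H.
        (\<forall>x\<in>carrier G. \<forall>\<alpha>\<in>carrier H. l1 x \<alpha> \<ominus>\<^bsub>H\<^esub> l2 x \<alpha> = ad_left H (\<phi> x) \<alpha>) \<and>
        (\<forall>x\<in>carrier G. \<forall>\<alpha>\<in>carrier H. r1 x \<alpha> \<ominus>\<^bsub>H\<^esub> r2 x \<alpha> = ad_right H (\<phi> x) \<alpha>) \<and>
        (\<forall>x\<in>carrier G. \<forall>y\<in>carrier G.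
           \<omega>1 x y \<ominus>\<^bsub>H\<^esub> \<omega>2 x y =
           l2 x (\<phi> y) \<oplus>\<^bsub>H\<^esub> r2 y (\<phi> x) \<oplus>\<^bsub>H\<^esub> \<lbrakk>\<phi> x, \<phi> y\<rbrakk>\<^bsub>H\<^esub> \<ominus>\<^bsub>H\<^esub> \<phi> \<lbrakk>x, y\<rbrakk>\<^bsub>G\<^esub>))}"

definition cohomology2 ::
    "('k, 'm) ring_scheme \<Rightarrow> ('k, 'g, 'n) leibniz_scheme \<Rightarrow> ('k, 'h, 'p) leibniz_scheme
     \<Rightarrow> ('g, 'h) cochain set set" where
  "cohomology2 K G H = cocycles2 K G H // cocycle_rel K G H"

text \<open>
  An extension is a triple \<open>(E, i, p)\<close>; the type \<open>'e\<close> is the universe in which the carrier of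
  \<open>E\<close> lives.
\<close>

type_synonym ('k, 'g, 'h, 'e) extension = "('k, 'e) leibniz \<times> ('h \<Rightarrow> 'e) \<times> ('e \<Rightarrow> 'g)"

definition extensions ::
    "('k, 'm) ring_scheme \<Rightarrow> ('k, 'g, 'n) leibniz_scheme \<Rightarrow> ('k, 'h, 'p) leibniz_scheme
     \<Rightarrow> ('k, 'g, 'h, 'e) extension set" where
  "extensions K G H = {(E, i, p).
     leibniz_algebra K E \<and> i \<in> leibniz_hom K H E \<and> p \<in> leibniz_hom K E G \<and>
     inj_on i (carrier H) \<and>
     i ` carrier H = {e \<in> carrier E. p e = \<zero>\<^bsub>G\<^esub>} \<and>
     p ` carrier E = carrier G}"

definition extension_rel ::
    "('k, 'm) ring_scheme \<Rightarrow> ('k, 'g, 'n) leibniz_scheme \<Rightarrow> ('k, 'h, 'p) leibniz_scheme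
     \<Rightarrow> (('k, 'g, 'h, 'e) extension \<times> ('k, 'g, 'h, 'e) extension) set" where
  "extension_rel K G H = {((E1, i1, p1), (E2, i2, p2)).
     (E1, i1, p1) \<in> extensions K G H \<and> (E2, i2, p2) \<in> extensions K G H \<and>
     (\<exists>\<theta>\<in>leibniz_hom K E2 E1.
        (\<forall>\<alpha>\<in>carrier H. \<theta> (i2 \<alpha>) = i1 \<alpha>) \<and> (\<forall>e\<in>carrier E2. p1 (\<theta> e) = p2 e))}"

definition splittings ::
    "('k, 'm) ring_scheme \<Rightarrow> ('k, 'g, 'n) leibniz_scheme \<Rightarrow> ('k, 'g, 'h, 'e) extension
     \<Rightarrow> ('g \<Rightarrow> 'e) set" where
  "splittings K G = (\<lambda>(E, i, p). {\<sigma> \<in> lin_maps K G E. \<forall>x\<in>carrier G. p (\<sigma> x) = x})"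

text \<open>The identification of \<open>H\<close> with its image \<open>i(H)\<close> is made explicit through the inverse of \<open>i\<close>.\<close>

definition splitting_cocycle ::
    "('k, 'g, 'n) leibniz_scheme \<Rightarrow> ('k, 'h, 'p) leibniz_scheme
     \<Rightarrow> ('k, 'g, 'h, 'e) extension \<Rightarrow> ('g \<Rightarrow> 'e) \<Rightarrow> ('g, 'h) cochain" where
  "splitting_cocycle G H = (\<lambda>(E, i, p) \<sigma>.
     ((\<lambda>x \<beta>. inv_into (carrier H) i \<lbrakk>\<sigma> x, i \<beta>\<rbrakk>\<^bsub>E\<^esub>),
      (\<lambda>y \<alpha>. inv_into (carrier H) i \<lbrakk>i \<alpha>, \<sigma> y\<rbrakk>\<^bsub>E\<^esub>),
      (\<lambda>x y. inv_into (carrier H) i (\<lbrakk>\<sigma> x, \<sigma> y\<rbrakk>\<^bsub>E\<^esub> \<ominus>\<^bsub>E\<^esub> \<sigma> \<lbrakk>x, y\<rbrakk>\<^bsub>G\<^esub>))))"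

end

theory Submission
  imports Defs
begin

text \<open>
  Everything is read off from one relation: an extension \<open>X\<close> \<^emph>\<open>realizes\<close> a cochain \<open>c\<close>
  (\<open>realizes\<close>, via the locale \<open>split_extension\<close>) when some linear splitting \<open>\<sigma>\<close> of \<open>X\<close> produces
  \<open>c = (l, r, \<omega>)\<close>, that is
  \<open>[\<sigma> x, \<beta>] = l x \<beta>\<close>, \<open>[\<alpha>, \<sigma> y] = r y \<alpha>\<close> and \<open>[\<sigma> x, \<sigma> y] = \<sigma> [x, y] + \<omega> x y\<close>.
  Once \<open>\<sigma>\<close> is chosen, every element of the extension is uniquely \<open>\<sigma> x + \<alpha>\<close>, and bilinearity gives
  \<open>[\<sigma> x + \<alpha>, \<sigma> y + \<beta>] = \<sigma> [x, y] + (\<omega> x y + l x \<beta> + r y \<alpha> + [\<alpha>, \<beta>])\<close>,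
  so the extension and its cocycle determine each other. In detail:

  \<^item> A realized cochain is a cocycle: the cocycle conditions are instances of the Leibniz identity in
    the extension, or sums of two (\<open>split_extension.cocycle\<close>). Conversely the bracket formula above defines a
    Leibniz algebra for every cocycle, so every cocycle is realized (\<open>cocycle_split_extension\<close>).
  \<^item> Every extension realizes some cocycle, because a surjective linear map splits
    (\<open>surjective_lin_map_splits\<close>, by Zorn's lemma).
  \<^item> Two extensions realizing the same cocycle are isomorphic, by matching \<open>\<sigma> x + \<alpha>\<close> on both sides
    (\<open>split_extension_isomorphic\<close>), and isomorphic extensions realize the same cocycles, because a
    splitting can be composed with the isomorphism \<open>\<theta>\<close> (\<open>split_extension_transport\<close>).
  \<^item> Two splittings of one extension differ by a linear map \<open>\<phi>\<close> into the kernel, and their cocycles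
    are then equivalent through \<open>\<phi>\<close> (\<open>splittings_cocycle_rel\<close>). Conversely, adding \<open>\<phi>\<close> to a
    splitting realizes any cocycle equivalent to a realized one (\<open>equivalent_cocycle_splitting\<close>).

  Hence two cocycles are equivalent exactly when some extension realizes both, two extensions are
  isomorphic exactly when some cocycle is realized by both, and the set of cocycles realized by an
  extension is a full equivalence class of cocycles. The remaining claims are formal consequences,
  including symmetry and transitivity of both relations, which otherwise require inverting \<open>\<theta>\<close>
  and computing with sums of maps \<open>\<phi>\<close>.
\<close>

section \<open>Linear maps\<close>

lemma (in abelian_group) minus_eq_iff:
  assumes "x \<in> carrier G" "y \<in> carrier G" "z \<in> carrier G"
  shows "x \<ominus> y = z \<longleftrightarrow> x = z \<oplus> y"
proof
  assume "x \<ominus> y = z"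
  then have "z \<oplus> y = x \<oplus> (\<ominus> y \<oplus> y)"
    using assms by (simp add: minus_eq a_assoc flip: \<open>x \<ominus> y = z\<close>)
  then show "x = z \<oplus> y" using assms by (simp add: l_neg)
next
  assume "x = z \<oplus> y"
  then show "x \<ominus> y = z" using assms by (simp add: minus_eq a_assoc r_neg)
qed

lemma (in abelian_group) minus_eq_minus_iff:
  assumes "x \<in> carrier G" "y \<in> carrier G" "z \<in> carrier G" "w \<in> carrier G"
  shows "x \<ominus> y = z \<ominus> w \<longleftrightarrow> x \<oplus> w = z \<oplus> y"
proof -
  have "x \<ominus> y = z \<ominus> w \<longleftrightarrow> (z \<oplus> y) \<ominus> w = x"
    using assms minus_eq_iff[of x y "z \<ominus> w"] by (simp add: minus_eq a_ac eq_commute[of x])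
  then show ?thesis using assms minus_eq_iff[of "z \<oplus> y" w x] by auto
qed

text \<open>
  The two sides have the shape of the last cocycle condition; the right-hand form is free of
  negatives, so that it can be used by rearranging sums.
\<close>

lemma (in abelian_group) minus_minus_eq_minus_add_iff:
  assumes "x \<in> carrier G" "y \<in> carrier G" "z \<in> carrier G"
    and "u \<in> carrier G" "v \<in> carrier G" "w \<in> carrier G"
  shows "x \<ominus> y \<ominus> z = u \<ominus> v \<oplus> w \<longleftrightarrow> x \<oplus> v = u \<oplus> w \<oplus> (y \<oplus> z)"
proof -
  have "x \<ominus> y \<ominus> z = x \<ominus> (y \<oplus> z)" "u \<ominus> v \<oplus> w = (u \<oplus> w) \<ominus> v"
    using assms by (simp_all add: minus_eq minus_add a_ac)
  then show ?thesis using assms by (simp only: minus_eq_minus_iff a_closed)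
qed

lemma lin_mapsI:
  assumes "\<And>x. x \<in> carrier V \<Longrightarrow> f x \<in> carrier W"
    and "\<And>x y. x \<in> carrier V \<Longrightarrow> y \<in> carrier V \<Longrightarrow> f (x \<oplus>\<^bsub>V\<^esub> y) = f x \<oplus>\<^bsub>W\<^esub> f y"
    and "\<And>a x. a \<in> carrier K \<Longrightarrow> x \<in> carrier V \<Longrightarrow> f (a \<odot>\<^bsub>V\<^esub> x) = a \<odot>\<^bsub>W\<^esub> f x"
  shows "f \<in> lin_maps K V W"
  using assms by (auto simp: lin_maps_def)

lemma
  assumes "f \<in> lin_maps K V W"
  shows lin_maps_closed: "x \<in> carrier V \<Longrightarrow> f x \<in> carrier W"
    and lin_maps_add: "x \<in> carrier V \<Longrightarrow> y \<in> carrier V \<Longrightarrow> f (x \<oplus>\<^bsub>V\<^esub> y) = f x \<oplus>\<^bsub>W\<^esub> f y"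
    and lin_maps_smult: "a \<in> carrier K \<Longrightarrow> x \<in> carrier V \<Longrightarrow> f (a \<odot>\<^bsub>V\<^esub> x) = a \<odot>\<^bsub>W\<^esub> f x"
  using assms by (auto simp: lin_maps_def)

lemma
  assumes "abelian_group V" "abelian_group W" and f: "f \<in> lin_maps K V W"
  shows lin_maps_zero: "f \<zero>\<^bsub>V\<^esub> = \<zero>\<^bsub>W\<^esub>"
    and lin_maps_minus: "x \<in> carrier V \<Longrightarrow> y \<in> carrier V \<Longrightarrow> f (x \<ominus>\<^bsub>V\<^esub> y) = f x \<ominus>\<^bsub>W\<^esub> f y"
proof -
  interpret V: abelian_group V by fact
  interpret W: abelian_group W by fact
  note c = lin_maps_closed[OF f]
  have "f \<zero>\<^bsub>V\<^esub> \<oplus>\<^bsub>W\<^esub> f \<zero>\<^bsub>V\<^esub> = f \<zero>\<^bsub>V\<^esub>"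
    using lin_maps_add[OF f, of "\<zero>\<^bsub>V\<^esub>" "\<zero>\<^bsub>V\<^esub>"] by simp
  then show "f \<zero>\<^bsub>V\<^esub> = \<zero>\<^bsub>W\<^esub>" using c[of "\<zero>\<^bsub>V\<^esub>"] by (metis V.zero_closed W.add.l_cancel_one')
  show "f (x \<ominus>\<^bsub>V\<^esub> y) = f x \<ominus>\<^bsub>W\<^esub> f y" if xy: "x \<in> carrier V" "y \<in> carrier V"
  proof -
    have "f x = f ((x \<ominus>\<^bsub>V\<^esub> y) \<oplus>\<^bsub>V\<^esub> y)" using xy V.minus_eq_iff[of x y "x \<ominus>\<^bsub>V\<^esub> y"] by simp
    also have "\<dots> = f (x \<ominus>\<^bsub>V\<^esub> y) \<oplus>\<^bsub>W\<^esub> f y" using xy by (simp add: lin_maps_add[OF f])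
    finally show ?thesis using W.minus_eq_iff[of "f x" "f y" "f (x \<ominus>\<^bsub>V\<^esub> y)"] c xy by simp
  qed
qed

text \<open>
  A maximal subspace \<open>W\<close> meeting the kernel only in \<open>\<zero>\<close> is a complement of the kernel:
  if \<open>p e\<close> were not in \<open>p(W)\<close>, then \<open>W + Ke\<close> would still meet the kernel only in \<open>\<zero>\<close>. So \<open>p\<close>
  maps \<open>W\<close> bijectively onto the target, and the inverse of this bijection splits \<open>p\<close>.
\<close>

lemma surjective_lin_map_splits:
  assumes "field K" "module K V" "module K U" and p: "p \<in> lin_maps K V U"
    and surj: "p ` carrier V = carrier U"
  shows "\<exists>\<sigma> \<in> lin_maps K U V. \<forall>x\<in>carrier U. p (\<sigma> x) = x"
proof -
  interpret K: field K by fact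
  interpret V: module K V by fact
  interpret U: module K U by fact
  note p_c = lin_maps_closed[OF p] and p_add = lin_maps_add[OF p] and p_smult = lin_maps_smult[OF p]
  note p_0 = lin_maps_zero[OF V.abelian_group_axioms U.abelian_group_axioms p]
  note p_minus = lin_maps_minus[OF V.abelian_group_axioms U.abelian_group_axioms p]
  (* Subspaces meeting the kernel trivially. The last condition passes to unions of chains, whereas
     being a complement does not; that a maximal one is a complement is shown afterwards. *)
  define \<W> where "\<W> = {W. W \<subseteq> carrier V \<and> \<zero>\<^bsub>V\<^esub> \<in> W \<and>
    (\<forall>v\<in>W. \<forall>w\<in>W. v \<oplus>\<^bsub>V\<^esub> w \<in> W) \<and> (\<forall>a\<in>carrier K. \<forall>w\<in>W. a \<odot>\<^bsub>V\<^esub> w \<in> W) \<and>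
    (\<forall>w\<in>W. p w = \<zero>\<^bsub>U\<^esub> \<longrightarrow> w = \<zero>\<^bsub>V\<^esub>)}"
  have "\<exists>W\<in>\<W>. \<forall>X\<in>\<W>. W \<subseteq> X \<longrightarrow> X = W"
  proof (rule subset_Zorn_nonempty)
    show "\<W> \<noteq> {}" by (auto simp: \<W>_def intro!: exI[of _ "{\<zero>\<^bsub>V\<^esub>}"])
    fix \<C> assume ne: "\<C> \<noteq> {}" and ch: "subset.chain \<W> \<C>"
    have sub: "\<C> \<subseteq> \<W>" and lin: "\<And>X Y. X \<in> \<C> \<Longrightarrow> Y \<in> \<C> \<Longrightarrow> X \<subseteq> Y \<or> Y \<subseteq> X"
      using ch by (auto simp: subset_chain_def)
    have add: "v \<oplus>\<^bsub>V\<^esub> w \<in> \<Union>\<C>" if vw: "v \<in> X" "X \<in> \<C>" "w \<in> Y" "Y \<in> \<C>" for v w X Y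
    proof -
      obtain Z where Z: "Z \<in> \<C>" "v \<in> Z" "w \<in> Z" using lin[of X Y] vw by blast
      then have "v \<oplus>\<^bsub>V\<^esub> w \<in> Z" using sub unfolding \<W>_def by blast
      then show ?thesis using Z by blast
    qed
    show "\<Union>\<C> \<in> \<W>" unfolding \<W>_def mem_Collect_eq
    proof (intro conjI)
      show "\<Union>\<C> \<subseteq> carrier V" "\<zero>\<^bsub>V\<^esub> \<in> \<Union>\<C>"
        "\<forall>a\<in>carrier K. \<forall>w\<in>\<Union>\<C>. a \<odot>\<^bsub>V\<^esub> w \<in> \<Union>\<C>" "\<forall>w\<in>\<Union>\<C>. p w = \<zero>\<^bsub>U\<^esub> \<longrightarrow> w = \<zero>\<^bsub>V\<^esub>"
        using sub ne unfolding \<W>_def by blast+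
      show "\<forall>v\<in>\<Union>\<C>. \<forall>w\<in>\<Union>\<C>. v \<oplus>\<^bsub>V\<^esub> w \<in> \<Union>\<C>" using add by blast
    qed
  qed
  then obtain W where W: "W \<in> \<W>" and max: "\<And>X. X \<in> \<W> \<Longrightarrow> W \<subseteq> X \<Longrightarrow> X = W" by blast
  have Wc: "\<And>w. w \<in> W \<Longrightarrow> w \<in> carrier V" and W0: "\<zero>\<^bsub>V\<^esub> \<in> W"
    and Wadd: "\<And>v w. v \<in> W \<Longrightarrow> w \<in> W \<Longrightarrow> v \<oplus>\<^bsub>V\<^esub> w \<in> W"
    and Wsm: "\<And>a w. a \<in> carrier K \<Longrightarrow> w \<in> W \<Longrightarrow> a \<odot>\<^bsub>V\<^esub> w \<in> W"
    and Wker: "\<And>w. w \<in> W \<Longrightarrow> p w = \<zero>\<^bsub>U\<^esub> \<Longrightarrow> w = \<zero>\<^bsub>V\<^esub>"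
    using W unfolding \<W>_def by auto
  have Wminus: "v \<ominus>\<^bsub>V\<^esub> w \<in> W" if "v \<in> W" "w \<in> W" for v w
  proof -
    have "\<ominus>\<^bsub>V\<^esub> w = (\<ominus>\<^bsub>K\<^esub> \<one>\<^bsub>K\<^esub>) \<odot>\<^bsub>V\<^esub> w" using Wc[OF that(2)] by (simp add: V.smult_l_minus)
    then show ?thesis unfolding V.minus_eq using Wadd Wsm that by simp
  qed
  have inj: "v = w" if "v \<in> W" "w \<in> W" "p v = p w" for v w
  proof -
    have "p (v \<ominus>\<^bsub>V\<^esub> w) = \<zero>\<^bsub>U\<^esub>" using that Wc p_c by (simp add: p_minus U.M.minus_eq U.M.r_neg)
    then have "v \<ominus>\<^bsub>V\<^esub> w = \<zero>\<^bsub>V\<^esub>" using Wker Wminus that by blast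
    then show ?thesis using that Wc V.M.minus_eq_iff[of v w "\<zero>\<^bsub>V\<^esub>"] by simp
  qed
  have onto: "\<exists>w\<in>W. p w = g" if g: "g \<in> carrier U" for g
  proof (rule ccontr)
    assume no: "\<not> ?thesis"
    have "g \<in> p ` carrier V" using surj g by simp
    then obtain e where e: "e \<in> carrier V" "p e = g" by auto
    define X where "X = {w \<oplus>\<^bsub>V\<^esub> a \<odot>\<^bsub>V\<^esub> e |w a. w \<in> W \<and> a \<in> carrier K}"
    have XI: "w \<oplus>\<^bsub>V\<^esub> a \<odot>\<^bsub>V\<^esub> e \<in> X" if "w \<in> W" "a \<in> carrier K" for w a
      using that unfolding X_def by blast
    (* If w + a e lies in the kernel with a nonzero, then g = p (- w / a), contrary to the choice
       of g; hence a = 0 and W + K e still meets the kernel trivially. *)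
    have "X \<in> \<W>" unfolding \<W>_def mem_Collect_eq
    proof (intro conjI ballI impI)
      show "X \<subseteq> carrier V" using Wc e by (auto simp: X_def)
      have 0: "\<zero>\<^bsub>V\<^esub> \<oplus>\<^bsub>V\<^esub> \<zero>\<^bsub>K\<^esub> \<odot>\<^bsub>V\<^esub> e = \<zero>\<^bsub>V\<^esub>" using e by simp
      show "\<zero>\<^bsub>V\<^esub> \<in> X" using XI[OF W0, of "\<zero>\<^bsub>K\<^esub>"] unfolding 0 by simp
      fix v assume "v \<in> X"
      then obtain w a where v: "v = w \<oplus>\<^bsub>V\<^esub> a \<odot>\<^bsub>V\<^esub> e" "w \<in> W" "a \<in> carrier K" unfolding X_def by blast
      {
        fix v' assume "v' \<in> X"
        then obtain w' a' where v': "v' = w' \<oplus>\<^bsub>V\<^esub> a' \<odot>\<^bsub>V\<^esub> e" "w' \<in> W" "a' \<in> carrier K" unfolding X_def by blast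
        have "v \<oplus>\<^bsub>V\<^esub> v' = (w \<oplus>\<^bsub>V\<^esub> w') \<oplus>\<^bsub>V\<^esub> (a \<oplus>\<^bsub>K\<^esub> a') \<odot>\<^bsub>V\<^esub> e"
          using v v' e Wc by (simp add: V.smult_l_distr V.M.a_ac)
        then show "v \<oplus>\<^bsub>V\<^esub> v' \<in> X" using XI v v' Wadd by simp
      next
        fix b assume b: "b \<in> carrier K"
        have "b \<odot>\<^bsub>V\<^esub> v = b \<odot>\<^bsub>V\<^esub> w \<oplus>\<^bsub>V\<^esub> (b \<otimes>\<^bsub>K\<^esub> a) \<odot>\<^bsub>V\<^esub> e"
          using v e b Wc by (simp add: V.smult_r_distr V.smult_assoc1)
        then show "b \<odot>\<^bsub>V\<^esub> v \<in> X" using XI v b Wsm by simp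
      next
        assume "p v = \<zero>\<^bsub>U\<^esub>"
        then have ker: "p w \<oplus>\<^bsub>U\<^esub> a \<odot>\<^bsub>U\<^esub> g = \<zero>\<^bsub>U\<^esub>" using v e Wc by (simp add: p_add p_smult)
        have "a = \<zero>\<^bsub>K\<^esub>"
        proof (rule ccontr)
          assume "a \<noteq> \<zero>\<^bsub>K\<^esub>"
          then have a: "inv\<^bsub>K\<^esub> a \<in> carrier K" "inv\<^bsub>K\<^esub> a \<otimes>\<^bsub>K\<^esub> a = \<one>\<^bsub>K\<^esub>"
            using v(3) K.field_Units by auto
          have "\<zero>\<^bsub>U\<^esub> = inv\<^bsub>K\<^esub> a \<odot>\<^bsub>U\<^esub> (p w \<oplus>\<^bsub>U\<^esub> a \<odot>\<^bsub>U\<^esub> g)" using ker a by simp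
          also have "\<dots> = inv\<^bsub>K\<^esub> a \<odot>\<^bsub>U\<^esub> p w \<oplus>\<^bsub>U\<^esub> (inv\<^bsub>K\<^esub> a \<otimes>\<^bsub>K\<^esub> a) \<odot>\<^bsub>U\<^esub> g"
            using a(1) v g Wc p_c by (simp add: U.smult_r_distr U.smult_assoc1)
          also have "\<dots> = p (inv\<^bsub>K\<^esub> a \<odot>\<^bsub>V\<^esub> w) \<oplus>\<^bsub>U\<^esub> g" using a v g Wc by (simp add: p_smult)
          finally have "g = \<zero>\<^bsub>U\<^esub> \<ominus>\<^bsub>U\<^esub> p (inv\<^bsub>K\<^esub> a \<odot>\<^bsub>V\<^esub> w)"
            using a v g Wc p_c U.M.minus_eq_iff[of "\<zero>\<^bsub>U\<^esub>" "p (inv\<^bsub>K\<^esub> a \<odot>\<^bsub>V\<^esub> w)" g] by (simp add: U.M.a_comm)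
          also have "\<dots> = p (\<zero>\<^bsub>V\<^esub> \<ominus>\<^bsub>V\<^esub> inv\<^bsub>K\<^esub> a \<odot>\<^bsub>V\<^esub> w)" using a v Wc by (simp add: p_minus p_0)
          finally show False using no Wminus[OF W0] Wsm a v by metis
        qed
        then show "v = \<zero>\<^bsub>V\<^esub>" using ker v e g Wc p_c Wker by simp
      }
    qed
    moreover have "W \<subseteq> X"
    proof
      fix w assume w: "w \<in> W"
      then have "w = w \<oplus>\<^bsub>V\<^esub> \<zero>\<^bsub>K\<^esub> \<odot>\<^bsub>V\<^esub> e" using e Wc by simp
      then show "w \<in> X" using XI[OF w, of "\<zero>\<^bsub>K\<^esub>"] by simp
    qed
    ultimately have "X = W" by (rule max)
    moreover have "\<zero>\<^bsub>V\<^esub> \<oplus>\<^bsub>V\<^esub> \<one>\<^bsub>K\<^esub> \<odot>\<^bsub>V\<^esub> e = e" using e by simp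
    then have "e \<in> X" using XI[OF W0, of "\<one>\<^bsub>K\<^esub>"] by simp
    ultimately show False using no e by blast
  qed
  define \<sigma> where "\<sigma> g = (SOME w. w \<in> W \<and> p w = g)" for g
  have \<sigma>: "\<sigma> g \<in> W" "p (\<sigma> g) = g" if "g \<in> carrier U" for g
    using someI_ex[of "\<lambda>w. w \<in> W \<and> p w = g"] onto[OF that] unfolding \<sigma>_def by blast+
  have "\<sigma> \<in> lin_maps K U V"
  proof (rule lin_mapsI)
    show "\<sigma> x \<in> carrier V" if "x \<in> carrier U" for x using \<sigma> Wc that by blast
    show "\<sigma> (x \<oplus>\<^bsub>U\<^esub> y) = \<sigma> x \<oplus>\<^bsub>V\<^esub> \<sigma> y" if "x \<in> carrier U" "y \<in> carrier U" for x y
      using that by (intro inj) (simp_all add: \<sigma> Wadd p_add Wc)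
    show "\<sigma> (a \<odot>\<^bsub>U\<^esub> x) = a \<odot>\<^bsub>V\<^esub> \<sigma> x" if "a \<in> carrier K" "x \<in> carrier U" for a x
      using that by (intro inj) (simp_all add: \<sigma> Wsm p_smult Wc)
  qed
  then show ?thesis using \<sigma> by blast
qed

section \<open>Split extensions\<close>

text \<open>
  An extension with a chosen splitting and the cochain that it produces. The kernel is not
  identified with \<open>H\<close>, so the defining equations of \<open>(l, r, \<omega>)\<close> are stated after applying \<open>i\<close>. The
  cochain is a parameter, constrained on the carriers only, instead of being defined from \<open>\<sigma>\<close>: thus
  one and the same cochain can belong to several extensions. Exactness at \<open>G\<close> follows from the
  existence of \<open>\<sigma>\<close>.
\<close>

locale split_extension =
  G: leibniz_algebra K G + H: leibniz_algebra K H + E: leibniz_algebra K E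
  for K :: "('k, 'm) ring_scheme" and G :: "('k, 'g, 'n) leibniz_scheme"
    and H :: "('k, 'h, 'q) leibniz_scheme" and E :: "('k, 'e) leibniz" +
  fixes i :: "'h \<Rightarrow> 'e" and p :: "'e \<Rightarrow> 'g" and \<sigma> :: "'g \<Rightarrow> 'e"
    and l :: "'g \<Rightarrow> 'h \<Rightarrow> 'h" and r :: "'g \<Rightarrow> 'h \<Rightarrow> 'h" and \<omega> :: "'g \<Rightarrow> 'g \<Rightarrow> 'h"
  assumes i_hom: "i \<in> leibniz_hom K H E" and p_hom: "p \<in> leibniz_hom K E G"
    and i_inj: "inj_on i (carrier H)"
    and exact: "i ` carrier H = {e \<in> carrier E. p e = \<zero>\<^bsub>G\<^esub>}"
    and \<sigma>_lin: "\<sigma> \<in> lin_maps K G E"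
    and p_\<sigma> [simp]: "x \<in> carrier G \<Longrightarrow> p (\<sigma> x) = x"
    and l_closed [simp]: "x \<in> carrier G \<Longrightarrow> \<beta> \<in> carrier H \<Longrightarrow> l x \<beta> \<in> carrier H"
    and r_closed [simp]: "y \<in> carrier G \<Longrightarrow> \<alpha> \<in> carrier H \<Longrightarrow> r y \<alpha> \<in> carrier H"
    and \<omega>_closed [simp]: "x \<in> carrier G \<Longrightarrow> y \<in> carrier G \<Longrightarrow> \<omega> x y \<in> carrier H"
    and i_l: "x \<in> carrier G \<Longrightarrow> \<beta> \<in> carrier H \<Longrightarrow> i (l x \<beta>) = \<lbrakk>\<sigma> x, i \<beta>\<rbrakk>\<^bsub>E\<^esub>"
    and i_r: "y \<in> carrier G \<Longrightarrow> \<alpha> \<in> carrier H \<Longrightarrow> i (r y \<alpha>) = \<lbrakk>i \<alpha>, \<sigma> y\<rbrakk>\<^bsub>E\<^esub>"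
    and \<sigma>_bracket: "x \<in> carrier G \<Longrightarrow> y \<in> carrier G \<Longrightarrow>
      \<lbrakk>\<sigma> x, \<sigma> y\<rbrakk>\<^bsub>E\<^esub> = \<sigma> \<lbrakk>x, y\<rbrakk>\<^bsub>G\<^esub> \<oplus>\<^bsub>E\<^esub> i (\<omega> x y)"
begin

lemmas brackets_closed [simp] = G.bracket_closed H.bracket_closed E.bracket_closed

lemma i_lin: "i \<in> lin_maps K H E" and p_lin: "p \<in> lin_maps K E G"
  using i_hom p_hom by (auto simp: leibniz_hom_def)

lemmas i_simps [simp] = lin_maps_closed[OF i_lin] lin_maps_add[OF i_lin] lin_maps_smult[OF i_lin]
  lin_maps_zero[OF H.abelian_group_axioms E.abelian_group_axioms i_lin]
  lin_maps_minus[OF H.abelian_group_axioms E.abelian_group_axioms i_lin]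
lemmas p_simps [simp] = lin_maps_closed[OF p_lin] lin_maps_add[OF p_lin] lin_maps_smult[OF p_lin]
  lin_maps_minus[OF E.abelian_group_axioms G.abelian_group_axioms p_lin]
lemmas \<sigma>_simps [simp] = lin_maps_closed[OF \<sigma>_lin] lin_maps_add[OF \<sigma>_lin] lin_maps_smult[OF \<sigma>_lin]
  lin_maps_zero[OF G.abelian_group_axioms E.abelian_group_axioms \<sigma>_lin]

lemma i_bracket [simp]:
  "\<alpha> \<in> carrier H \<Longrightarrow> \<beta> \<in> carrier H \<Longrightarrow> i \<lbrakk>\<alpha>, \<beta>\<rbrakk>\<^bsub>H\<^esub> = \<lbrakk>i \<alpha>, i \<beta>\<rbrakk>\<^bsub>E\<^esub>"
  using i_hom by (auto simp: leibniz_hom_def)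

lemma p_bracket [simp]:
  "e \<in> carrier E \<Longrightarrow> f \<in> carrier E \<Longrightarrow> p \<lbrakk>e, f\<rbrakk>\<^bsub>E\<^esub> = \<lbrakk>p e, p f\<rbrakk>\<^bsub>G\<^esub>"
  using p_hom by (auto simp: leibniz_hom_def)

lemma p_i [simp]: "\<alpha> \<in> carrier H \<Longrightarrow> p (i \<alpha>) = \<zero>\<^bsub>G\<^esub>"
  using exact by blast

lemma i_eqD: "i \<alpha> = i \<beta> \<Longrightarrow> \<alpha> \<in> carrier H \<Longrightarrow> \<beta> \<in> carrier H \<Longrightarrow> \<alpha> = \<beta>"
  using i_inj by (rule inj_onD)

lemma extension: "(E, i, p) \<in> extensions K G H"
proof -
  have "p ` carrier E = carrier G"
  proof
    show "p ` carrier E \<subseteq> carrier G" by auto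
    show "carrier G \<subseteq> p ` carrier E"
    proof
      fix x assume "x \<in> carrier G"
      then have "x = p (\<sigma> x)" "\<sigma> x \<in> carrier E" by simp_all
      then show "x \<in> p ` carrier E" by blast
    qed
  qed
  then show ?thesis
    using i_hom p_hom i_inj exact E.leibniz_algebra_axioms by (simp add: extensions_def)
qed

lemma element_cases:
  assumes "e \<in> carrier E"
  obtains x \<alpha> where "x \<in> carrier G" "\<alpha> \<in> carrier H" "e = \<sigma> x \<oplus>\<^bsub>E\<^esub> i \<alpha>"
proof -
  let ?d = "e \<ominus>\<^bsub>E\<^esub> \<sigma> (p e)"
  have "p ?d = \<zero>\<^bsub>G\<^esub>" using assms by (simp add: G.M.minus_eq G.M.r_neg)
  then have "?d \<in> i ` carrier H" using assms by (simp add: exact)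
  then obtain \<alpha> where \<alpha>: "\<alpha> \<in> carrier H" "?d = i \<alpha>" by blast
  then have "e = \<sigma> (p e) \<oplus>\<^bsub>E\<^esub> i \<alpha>"
    using assms E.M.minus_eq_iff[of e "\<sigma> (p e)" "i \<alpha>"] by (simp add: E.M.a_comm)
  with \<alpha> assms show thesis by (intro that[of "p e" \<alpha>]) simp_all
qed

lemma element_eq_iff:
  assumes "x \<in> carrier G" "\<alpha> \<in> carrier H" "y \<in> carrier G" "\<beta> \<in> carrier H"
  shows "\<sigma> x \<oplus>\<^bsub>E\<^esub> i \<alpha> = \<sigma> y \<oplus>\<^bsub>E\<^esub> i \<beta> \<longleftrightarrow> x = y \<and> \<alpha> = \<beta>" (is "?e = ?f \<longleftrightarrow> _")
proof
  assume eq: "?e = ?f"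
  have "p ?e = x" "p ?f = y" using assms by simp_all
  with eq have "x = y" by simp
  with eq show "x = y \<and> \<alpha> = \<beta>" using assms i_eqD by simp
qed simp

lemma element_add:
  assumes "x \<in> carrier G" "\<alpha> \<in> carrier H" "y \<in> carrier G" "\<beta> \<in> carrier H"
  shows "(\<sigma> x \<oplus>\<^bsub>E\<^esub> i \<alpha>) \<oplus>\<^bsub>E\<^esub> (\<sigma> y \<oplus>\<^bsub>E\<^esub> i \<beta>) = \<sigma> (x \<oplus>\<^bsub>G\<^esub> y) \<oplus>\<^bsub>E\<^esub> i (\<alpha> \<oplus>\<^bsub>H\<^esub> \<beta>)"
  using assms by (simp add: E.M.a_ac)

lemma element_smult:
  assumes "a \<in> carrier K" "x \<in> carrier G" "\<alpha> \<in> carrier H"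
  shows "a \<odot>\<^bsub>E\<^esub> (\<sigma> x \<oplus>\<^bsub>E\<^esub> i \<alpha>) = \<sigma> (a \<odot>\<^bsub>G\<^esub> x) \<oplus>\<^bsub>E\<^esub> i (a \<odot>\<^bsub>H\<^esub> \<alpha>)"
  using assms by (simp add: E.smult_r_distr)

lemma element_bracket:
  assumes "x \<in> carrier G" "\<alpha> \<in> carrier H" "y \<in> carrier G" "\<beta> \<in> carrier H"
  shows "\<lbrakk>\<sigma> x \<oplus>\<^bsub>E\<^esub> i \<alpha>, \<sigma> y \<oplus>\<^bsub>E\<^esub> i \<beta>\<rbrakk>\<^bsub>E\<^esub> =
    \<sigma> \<lbrakk>x, y\<rbrakk>\<^bsub>G\<^esub> \<oplus>\<^bsub>E\<^esub> i (\<omega> x y \<oplus>\<^bsub>H\<^esub> l x \<beta> \<oplus>\<^bsub>H\<^esub> r y \<alpha> \<oplus>\<^bsub>H\<^esub> \<lbrakk>\<alpha>, \<beta>\<rbrakk>\<^bsub>H\<^esub>)"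
  using assms
  by (simp add: E.bracket_add_left E.bracket_add_right \<sigma>_bracket i_l i_r E.M.a_ac)

text \<open>
  The projection onto the kernel along the image of \<open>\<sigma>\<close>, read in \<open>H\<close>.
\<close>

definition kernel_part :: "'e \<Rightarrow> 'h" where
  "kernel_part e = (THE \<alpha>. \<alpha> \<in> carrier H \<and> e = \<sigma> (p e) \<oplus>\<^bsub>E\<^esub> i \<alpha>)"

lemma kernel_part_element [simp]:
  assumes "x \<in> carrier G" "\<alpha> \<in> carrier H"
  shows "kernel_part (\<sigma> x \<oplus>\<^bsub>E\<^esub> i \<alpha>) = \<alpha>"
  unfolding kernel_part_def using assms by (intro the_equality) (auto dest: i_eqD)

lemma element_kernel_part:
  assumes "e \<in> carrier E"
  shows "kernel_part e \<in> carrier H" "\<sigma> (p e) \<oplus>\<^bsub>E\<^esub> i (kernel_part e) = e"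
  by (rule element_cases[OF assms]; simp)+

lemma kernel_part_lin: "kernel_part \<in> lin_maps K E H"
proof (rule lin_mapsI)
  fix e assume e: "e \<in> carrier E"
  show "kernel_part e \<in> carrier H" using e by (rule element_kernel_part)
  fix f assume f: "f \<in> carrier E"
  obtain x \<alpha> y \<beta> where "x \<in> carrier G" "\<alpha> \<in> carrier H" "e = \<sigma> x \<oplus>\<^bsub>E\<^esub> i \<alpha>"
      "y \<in> carrier G" "\<beta> \<in> carrier H" "f = \<sigma> y \<oplus>\<^bsub>E\<^esub> i \<beta>"
    using e f by (metis element_cases)
  then show "kernel_part (e \<oplus>\<^bsub>E\<^esub> f) = kernel_part e \<oplus>\<^bsub>H\<^esub> kernel_part f"
    by (simp only: element_add kernel_part_element G.M.a_closed H.M.a_closed)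
next
  fix a e assume a: "a \<in> carrier K" and "e \<in> carrier E"
  then show "kernel_part (a \<odot>\<^bsub>E\<^esub> e) = a \<odot>\<^bsub>H\<^esub> kernel_part e"
    by (elim element_cases) (simp only: element_smult kernel_part_element G.smult_closed H.smult_closed)
qed

text \<open>
  Since \<open>i\<close> is injective, identities in \<open>H\<close> may be checked in \<open>E\<close>, where the actions and \<open>\<omega>\<close> are
  brackets. There \<open>l x\<close> is a left and \<open>r x\<close> a right derivation by the Leibniz identity for
  \<open>\<sigma> x, \<alpha>, \<beta>\<close> and for \<open>\<alpha>, \<beta>, \<sigma> x\<close>.
\<close>

lemma l_der: "x \<in> carrier G \<Longrightarrow> l x \<in> Der_left K H"
  unfolding Der_left_def
  by (auto intro!: lin_mapsI i_eqD
      simp: i_l E.bracket_add_right E.bracket_smult_right E.leibniz_identity[of "\<sigma> x"])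

lemma r_der:
  assumes "x \<in> carrier G"
  shows "r x \<in> Der_right K H"
proof -
  have "r x \<lbrakk>\<alpha>, \<beta>\<rbrakk>\<^bsub>H\<^esub> = \<lbrakk>\<alpha>, r x \<beta>\<rbrakk>\<^bsub>H\<^esub> \<ominus>\<^bsub>H\<^esub> \<lbrakk>\<beta>, r x \<alpha>\<rbrakk>\<^bsub>H\<^esub>"
    if "\<alpha> \<in> carrier H" "\<beta> \<in> carrier H" for \<alpha> \<beta>
  proof (rule i_eqD)
    have "\<lbrakk>i \<alpha>, \<lbrakk>i \<beta>, \<sigma> x\<rbrakk>\<^bsub>E\<^esub>\<rbrakk>\<^bsub>E\<^esub> \<ominus>\<^bsub>E\<^esub> \<lbrakk>i \<beta>, \<lbrakk>i \<alpha>, \<sigma> x\<rbrakk>\<^bsub>E\<^esub>\<rbrakk>\<^bsub>E\<^esub> = \<lbrakk>\<lbrakk>i \<alpha>, i \<beta>\<rbrakk>\<^bsub>E\<^esub>, \<sigma> x\<rbrakk>\<^bsub>E\<^esub>"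
      using assms that E.leibniz_identity[of "i \<alpha>" "i \<beta>" "\<sigma> x"]
      by (subst E.M.minus_eq_iff) simp_all
    then show "i (r x \<lbrakk>\<alpha>, \<beta>\<rbrakk>\<^bsub>H\<^esub>) = i (\<lbrakk>\<alpha>, r x \<beta>\<rbrakk>\<^bsub>H\<^esub> \<ominus>\<^bsub>H\<^esub> \<lbrakk>\<beta>, r x \<alpha>\<rbrakk>\<^bsub>H\<^esub>)"
      using assms that by (simp add: i_r)
  qed (use assms that in simp_all)
  then show ?thesis
    unfolding Der_right_def using assms
    by (auto intro!: lin_mapsI i_eqD simp: i_r E.bracket_add_left E.bracket_smult_left)
qed

lemma l_lin: "\<alpha> \<in> carrier H \<Longrightarrow> (\<lambda>x. l x \<alpha>) \<in> lin_maps K G H"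
  by (auto intro!: lin_mapsI i_eqD simp: i_l E.bracket_add_left E.bracket_smult_left)

lemma r_lin: "\<alpha> \<in> carrier H \<Longrightarrow> (\<lambda>x. r x \<alpha>) \<in> lin_maps K G H"
  by (auto intro!: lin_mapsI i_eqD simp: i_r E.bracket_add_right E.bracket_smult_right)

lemma \<omega>_kernel_part: "x \<in> carrier G \<Longrightarrow> y \<in> carrier G \<Longrightarrow> \<omega> x y = kernel_part \<lbrakk>\<sigma> x, \<sigma> y\<rbrakk>\<^bsub>E\<^esub>"
  by (simp add: \<sigma>_bracket)

lemma \<omega>_lin:
  assumes "x \<in> carrier G"
  shows "(\<lambda>y. \<omega> x y) \<in> lin_maps K G H" "(\<lambda>y. \<omega> y x) \<in> lin_maps K G H"
  by (auto intro!: lin_mapsI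
      simp: assms \<omega>_kernel_part E.bracket_add_left E.bracket_add_right E.bracket_smult_left
        E.bracket_smult_right lin_maps_add[OF kernel_part_lin] lin_maps_smult[OF kernel_part_lin]
        lin_maps_closed[OF kernel_part_lin])

text \<open>
  Add the Leibniz identities for \<open>a, b, c\<close> and for \<open>b, a, c\<close>. This fact is behind the two cocycle
  conditions that involve \<open>l x \<alpha> + r x \<alpha>\<close>, which in \<open>E\<close> is \<open>[\<sigma> x, \<alpha>] + [\<alpha>, \<sigma> x]\<close>.
\<close>

lemma symmetric_bracket:
  assumes "a \<in> carrier E" "b \<in> carrier E" "c \<in> carrier E"
  shows "\<lbrakk>\<lbrakk>a, b\<rbrakk>\<^bsub>E\<^esub> \<oplus>\<^bsub>E\<^esub> \<lbrakk>b, a\<rbrakk>\<^bsub>E\<^esub>, c\<rbrakk>\<^bsub>E\<^esub> = \<zero>\<^bsub>E\<^esub>"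
proof -
  have "\<lbrakk>a, \<lbrakk>b, c\<rbrakk>\<^bsub>E\<^esub>\<rbrakk>\<^bsub>E\<^esub> = \<lbrakk>\<lbrakk>a, b\<rbrakk>\<^bsub>E\<^esub> \<oplus>\<^bsub>E\<^esub> \<lbrakk>b, a\<rbrakk>\<^bsub>E\<^esub>, c\<rbrakk>\<^bsub>E\<^esub> \<oplus>\<^bsub>E\<^esub> \<lbrakk>a, \<lbrakk>b, c\<rbrakk>\<^bsub>E\<^esub>\<rbrakk>\<^bsub>E\<^esub>"
    using assms E.leibniz_identity[of a b c] E.leibniz_identity[of b a c]
    by (simp add: E.bracket_add_left E.M.a_assoc)
  then show ?thesis using assms by (simp add: E.M.add.l_cancel_one E.M.add.r_cancel_one')
qed

text \<open>
  The conditions on \<open>[l, l]\<close> and \<open>[l, r]\<close> are the Leibniz identities for \<open>\<sigma> x, \<sigma> y, \<alpha>\<close> and for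
  \<open>\<sigma> x, \<alpha>, \<sigma> y\<close>. The condition on \<open>\<omega>\<close> alone is the kernel part of the one for
  \<open>\<sigma> x, \<sigma> y, \<sigma> z\<close>.
\<close>

lemma cocycle: "(l, r, \<omega>) \<in> cocycles2 K G H"
proof -
  have 1: "\<lbrakk>l x \<alpha> \<oplus>\<^bsub>H\<^esub> r x \<alpha>, \<beta>\<rbrakk>\<^bsub>H\<^esub> = \<zero>\<^bsub>H\<^esub>"
    if "x \<in> carrier G" "\<alpha> \<in> carrier H" "\<beta> \<in> carrier H" for x \<alpha> \<beta>
    using that by (intro i_eqD) (simp_all add: i_l i_r symmetric_bracket)
  have 2: "commutator H (l x) (l y) \<alpha> \<ominus>\<^bsub>H\<^esub> l \<lbrakk>x, y\<rbrakk>\<^bsub>G\<^esub> \<alpha> = ad_left H (\<omega> x y) \<alpha>"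
    if "x \<in> carrier G" "y \<in> carrier G" "\<alpha> \<in> carrier H" for x y \<alpha>
    using that unfolding commutator_def ad_left_def
    by (intro i_eqD) (simp_all add: i_l E.M.minus_eq_iff E.leibniz_identity[of "\<sigma> x" "\<sigma> y" "i \<alpha>"]
        \<sigma>_bracket E.bracket_add_left E.M.a_ac)
  have 3: "commutator H (l x) (r y) \<alpha> \<ominus>\<^bsub>H\<^esub> r \<lbrakk>x, y\<rbrakk>\<^bsub>G\<^esub> \<alpha> = ad_right H (\<omega> x y) \<alpha>"
    if "x \<in> carrier G" "y \<in> carrier G" "\<alpha> \<in> carrier H" for x y \<alpha>
    using that unfolding commutator_def ad_right_def
    by (intro i_eqD) (simp_all add: i_l i_r E.M.minus_eq_iff E.leibniz_identity[of "\<sigma> x" "i \<alpha>" "\<sigma> y"]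
        \<sigma>_bracket E.bracket_add_right E.M.a_ac)
  have 4: "r y (r x \<alpha> \<oplus>\<^bsub>H\<^esub> l x \<alpha>) = \<zero>\<^bsub>H\<^esub>"
    if "x \<in> carrier G" "y \<in> carrier G" "\<alpha> \<in> carrier H" for x y \<alpha>
    using that by (intro i_eqD) (simp_all add: i_l i_r symmetric_bracket)
  have 5: "l x (\<omega> y z) \<ominus>\<^bsub>H\<^esub> l y (\<omega> x z) \<ominus>\<^bsub>H\<^esub> r z (\<omega> x y) =
      \<omega> \<lbrakk>x, y\<rbrakk>\<^bsub>G\<^esub> z \<ominus>\<^bsub>H\<^esub> \<omega> x \<lbrakk>y, z\<rbrakk>\<^bsub>G\<^esub> \<oplus>\<^bsub>H\<^esub> \<omega> y \<lbrakk>x, z\<rbrakk>\<^bsub>G\<^esub>"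
    if "x \<in> carrier G" "y \<in> carrier G" "z \<in> carrier G" for x y z
  proof -
    have nested: "\<lbrakk>\<sigma> a, \<lbrakk>\<sigma> b, \<sigma> c\<rbrakk>\<^bsub>E\<^esub>\<rbrakk>\<^bsub>E\<^esub> =
        \<sigma> \<lbrakk>a, \<lbrakk>b, c\<rbrakk>\<^bsub>G\<^esub>\<rbrakk>\<^bsub>G\<^esub> \<oplus>\<^bsub>E\<^esub> i (\<omega> a \<lbrakk>b, c\<rbrakk>\<^bsub>G\<^esub> \<oplus>\<^bsub>H\<^esub> l a (\<omega> b c))"
      if "a \<in> carrier G" "b \<in> carrier G" "c \<in> carrier G" for a b c
      using that by (simp add: \<sigma>_bracket E.bracket_add_right i_l E.M.a_assoc)
    have "\<lbrakk>\<lbrakk>\<sigma> x, \<sigma> y\<rbrakk>\<^bsub>E\<^esub>, \<sigma> z\<rbrakk>\<^bsub>E\<^esub> =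
        \<sigma> \<lbrakk>\<lbrakk>x, y\<rbrakk>\<^bsub>G\<^esub>, z\<rbrakk>\<^bsub>G\<^esub> \<oplus>\<^bsub>E\<^esub> i (\<omega> \<lbrakk>x, y\<rbrakk>\<^bsub>G\<^esub> z \<oplus>\<^bsub>H\<^esub> r z (\<omega> x y))"
      using that by (simp add: \<sigma>_bracket E.bracket_add_left i_r E.M.a_assoc)
    then have "\<sigma> \<lbrakk>x, \<lbrakk>y, z\<rbrakk>\<^bsub>G\<^esub>\<rbrakk>\<^bsub>G\<^esub> \<oplus>\<^bsub>E\<^esub> i (\<omega> x \<lbrakk>y, z\<rbrakk>\<^bsub>G\<^esub> \<oplus>\<^bsub>H\<^esub> l x (\<omega> y z)) =
        \<sigma> (\<lbrakk>\<lbrakk>x, y\<rbrakk>\<^bsub>G\<^esub>, z\<rbrakk>\<^bsub>G\<^esub> \<oplus>\<^bsub>G\<^esub> \<lbrakk>y, \<lbrakk>x, z\<rbrakk>\<^bsub>G\<^esub>\<rbrakk>\<^bsub>G\<^esub>) \<oplus>\<^bsub>E\<^esub>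
        i ((\<omega> \<lbrakk>x, y\<rbrakk>\<^bsub>G\<^esub> z \<oplus>\<^bsub>H\<^esub> r z (\<omega> x y)) \<oplus>\<^bsub>H\<^esub> (\<omega> y \<lbrakk>x, z\<rbrakk>\<^bsub>G\<^esub> \<oplus>\<^bsub>H\<^esub> l y (\<omega> x z)))"
      using that E.leibniz_identity[of "\<sigma> x" "\<sigma> y" "\<sigma> z"]
      by (simp only: nested element_add[symmetric] G.bracket_closed H.M.a_closed \<omega>_closed l_closed
          r_closed lin_maps_closed[OF \<sigma>_lin])
    then have "\<omega> x \<lbrakk>y, z\<rbrakk>\<^bsub>G\<^esub> \<oplus>\<^bsub>H\<^esub> l x (\<omega> y z) =
        (\<omega> \<lbrakk>x, y\<rbrakk>\<^bsub>G\<^esub> z \<oplus>\<^bsub>H\<^esub> r z (\<omega> x y)) \<oplus>\<^bsub>H\<^esub> (\<omega> y \<lbrakk>x, z\<rbrakk>\<^bsub>G\<^esub> \<oplus>\<^bsub>H\<^esub> l y (\<omega> x z))"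
      using that by (subst (asm) element_eq_iff) simp_all
    then show ?thesis
      using that by (subst H.M.minus_minus_eq_minus_add_iff) (simp_all add: H.M.a_ac)
  qed
  show ?thesis
    unfolding cocycles2_def using l_der r_der l_lin r_lin \<omega>_lin 1 2 3 4 5 by simp
qed

end

section \<open>Comparison of split extensions\<close>

text \<open>
  The map \<open>\<sigma>2 x + \<alpha> \<mapsto> \<sigma>1 x + \<alpha>\<close> is a morphism, because sums, multiples and brackets of such
  elements are given by the same formulas on both sides.
\<close>

lemma split_extension_isomorphic:
  assumes "split_extension K G H E1 i1 p1 \<sigma>1 l r \<omega>" "split_extension K G H E2 i2 p2 \<sigma>2 l r \<omega>"
  shows "((E1, i1, p1), (E2, i2, p2)) \<in> extension_rel K G H"
proof -
  interpret E1: split_extension K G H E1 i1 p1 \<sigma>1 l r \<omega> by fact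
  interpret E2: split_extension K G H E2 i2 p2 \<sigma>2 l r \<omega> by fact
  define \<theta> where "\<theta> e = \<sigma>1 (p2 e) \<oplus>\<^bsub>E1\<^esub> i1 (E2.kernel_part e)" for e
  have \<theta>: "\<theta> (\<sigma>2 x \<oplus>\<^bsub>E2\<^esub> i2 \<alpha>) = \<sigma>1 x \<oplus>\<^bsub>E1\<^esub> i1 \<alpha>" if "x \<in> carrier G" "\<alpha> \<in> carrier H" for x \<alpha>
    using that by (simp add: \<theta>_def)
  have \<theta>_closed: "\<theta> e \<in> carrier E1" if "e \<in> carrier E2" for e
    using that by (simp add: \<theta>_def E2.element_kernel_part)
  have "\<theta> \<in> lin_maps K E2 E1"
  proof (rule lin_mapsI)
    fix e f assume "e \<in> carrier E2" "f \<in> carrier E2"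
    then show "\<theta> (e \<oplus>\<^bsub>E2\<^esub> f) = \<theta> e \<oplus>\<^bsub>E1\<^esub> \<theta> f"
      by (elim E2.element_cases)
        (simp only: E1.element_add E2.element_add \<theta> E1.G.M.a_closed E1.H.M.a_closed)
  next
    fix a e assume "a \<in> carrier K" "e \<in> carrier E2"
    then show "\<theta> (a \<odot>\<^bsub>E2\<^esub> e) = a \<odot>\<^bsub>E1\<^esub> \<theta> e"
      by (elim E2.element_cases)
        (simp only: E1.element_smult E2.element_smult \<theta> E1.G.smult_closed E1.H.smult_closed)
  qed (rule \<theta>_closed)
  moreover have "\<theta> \<lbrakk>e, f\<rbrakk>\<^bsub>E2\<^esub> = \<lbrakk>\<theta> e, \<theta> f\<rbrakk>\<^bsub>E1\<^esub>" if "e \<in> carrier E2" "f \<in> carrier E2" for e f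
    using that by (elim E2.element_cases)
      (simp only: E1.element_bracket E2.element_bracket \<theta> E1.brackets_closed E1.H.M.a_closed
        E1.l_closed E1.r_closed E1.\<omega>_closed)
  moreover have "\<theta> (i2 \<alpha>) = i1 \<alpha>" if "\<alpha> \<in> carrier H" for \<alpha>
    using \<theta>[of "\<zero>\<^bsub>G\<^esub>" \<alpha>] that by simp
  moreover have "p1 (\<theta> e) = p2 e" if "e \<in> carrier E2" for e
    using that by (simp add: \<theta>_def E2.element_kernel_part)
  ultimately show ?thesis
    using E1.extension E2.extension by (auto simp: extension_rel_def leibniz_hom_def)
qed

text \<open>
  The linear map relating the two cocycles is the difference \<open>\<phi> = \<sigma>1 - \<sigma>2\<close>, which takes values in
  the kernel. The relation between \<open>\<omega>1\<close> and \<open>\<omega>2\<close> results from computing \<open>[\<sigma>1 x, \<sigma>1 y]\<close> in two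
  ways: by the definition of \<open>\<omega>1\<close>, and as the bracket of \<open>\<sigma>2 x + \<phi> x\<close> and \<open>\<sigma>2 y + \<phi> y\<close>.
\<close>

lemma splittings_cocycle_rel:
  assumes "split_extension K G H E i p \<sigma>1 l1 r1 \<omega>1" "split_extension K G H E i p \<sigma>2 l2 r2 \<omega>2"
  shows "((l1, r1, \<omega>1), (l2, r2, \<omega>2)) \<in> cocycle_rel K G H"
proof -
  interpret S1: split_extension K G H E i p \<sigma>1 l1 r1 \<omega>1 by fact
  interpret S2: split_extension K G H E i p \<sigma>2 l2 r2 \<omega>2 by fact
  define \<phi> where "\<phi> x = S2.kernel_part (\<sigma>1 x)" for x
  have \<phi>_closed [simp]: "\<phi> x \<in> carrier H" if "x \<in> carrier G" for x
    using that by (simp add: \<phi>_def S2.element_kernel_part)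
  have \<sigma>1: "\<sigma>1 x = \<sigma>2 x \<oplus>\<^bsub>E\<^esub> i (\<phi> x)" if "x \<in> carrier G" for x
    using that S2.element_kernel_part(2)[of "\<sigma>1 x"] by (simp add: \<phi>_def)
  have "\<phi> \<in> lin_maps K G H"
    by (rule lin_mapsI)
      (simp_all add: \<phi>_def S2.element_kernel_part lin_maps_add[OF S2.kernel_part_lin] lin_maps_smult[OF S2.kernel_part_lin])
  moreover have "l1 x \<alpha> \<ominus>\<^bsub>H\<^esub> l2 x \<alpha> = ad_left H (\<phi> x) \<alpha>"
    "r1 x \<alpha> \<ominus>\<^bsub>H\<^esub> r2 x \<alpha> = ad_right H (\<phi> x) \<alpha>" if "x \<in> carrier G" "\<alpha> \<in> carrier H" for x \<alpha>
    using that unfolding ad_left_def ad_right_def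
    by (auto intro!: S1.i_eqD simp: S1.H.M.minus_eq_iff S1.i_l S2.i_l S1.i_r S2.i_r \<sigma>1
        S1.E.bracket_add_left S1.E.bracket_add_right S1.E.M.a_comm)
  moreover have "\<omega>1 x y \<ominus>\<^bsub>H\<^esub> \<omega>2 x y =
      l2 x (\<phi> y) \<oplus>\<^bsub>H\<^esub> r2 y (\<phi> x) \<oplus>\<^bsub>H\<^esub> \<lbrakk>\<phi> x, \<phi> y\<rbrakk>\<^bsub>H\<^esub> \<ominus>\<^bsub>H\<^esub> \<phi> \<lbrakk>x, y\<rbrakk>\<^bsub>G\<^esub>"
    if xy: "x \<in> carrier G" "y \<in> carrier G" for x y
  proof -
    have "\<sigma>2 \<lbrakk>x, y\<rbrakk>\<^bsub>G\<^esub> \<oplus>\<^bsub>E\<^esub> i (\<phi> \<lbrakk>x, y\<rbrakk>\<^bsub>G\<^esub> \<oplus>\<^bsub>H\<^esub> \<omega>1 x y) = \<lbrakk>\<sigma>1 x, \<sigma>1 y\<rbrakk>\<^bsub>E\<^esub>"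
      using xy by (simp add: S1.\<sigma>_bracket \<sigma>1[of "\<lbrakk>x, y\<rbrakk>\<^bsub>G\<^esub>"] S1.E.M.a_assoc)
    also have "\<dots> = \<sigma>2 \<lbrakk>x, y\<rbrakk>\<^bsub>G\<^esub> \<oplus>\<^bsub>E\<^esub>
        i (\<omega>2 x y \<oplus>\<^bsub>H\<^esub> l2 x (\<phi> y) \<oplus>\<^bsub>H\<^esub> r2 y (\<phi> x) \<oplus>\<^bsub>H\<^esub> \<lbrakk>\<phi> x, \<phi> y\<rbrakk>\<^bsub>H\<^esub>)"
      using xy by (simp only: \<sigma>1 S2.element_bracket \<phi>_closed)
    finally have "\<phi> \<lbrakk>x, y\<rbrakk>\<^bsub>G\<^esub> \<oplus>\<^bsub>H\<^esub> \<omega>1 x y =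
        \<omega>2 x y \<oplus>\<^bsub>H\<^esub> l2 x (\<phi> y) \<oplus>\<^bsub>H\<^esub> r2 y (\<phi> x) \<oplus>\<^bsub>H\<^esub> \<lbrakk>\<phi> x, \<phi> y\<rbrakk>\<^bsub>H\<^esub>"
      using xy by (subst (asm) S2.element_eq_iff) simp_all
    then show ?thesis
      using xy by (subst S1.H.M.minus_eq_minus_iff) (simp_all add: S1.H.M.a_ac)
  qed
  ultimately show ?thesis
    using S1.cocycle S2.cocycle unfolding cocycle_rel_def by blast
qed

text \<open>
  The splitting is \<open>\<sigma> + \<phi>\<close>, where \<open>\<phi>\<close> is the map that relates the two cocycles.
\<close>

lemma equivalent_cocycle_splitting:
  assumes "((l1, r1, \<omega>1), (l2, r2, \<omega>2)) \<in> cocycle_rel K G H"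
    and "split_extension K G H E i p \<sigma> l2 r2 \<omega>2"
  obtains \<sigma>' where "split_extension K G H E i p \<sigma>' l1 r1 \<omega>1"
proof -
  interpret S: split_extension K G H E i p \<sigma> l2 r2 \<omega>2 by fact
  obtain \<phi> where cocycle: "(l1, r1, \<omega>1) \<in> cocycles2 K G H" and \<phi>: "\<phi> \<in> lin_maps K G H"
    and l: "\<And>x \<alpha>. x \<in> carrier G \<Longrightarrow> \<alpha> \<in> carrier H \<Longrightarrow> l1 x \<alpha> \<ominus>\<^bsub>H\<^esub> l2 x \<alpha> = \<lbrakk>\<phi> x, \<alpha>\<rbrakk>\<^bsub>H\<^esub>"
    and r: "\<And>x \<alpha>. x \<in> carrier G \<Longrightarrow> \<alpha> \<in> carrier H \<Longrightarrow> r1 x \<alpha> \<ominus>\<^bsub>H\<^esub> r2 x \<alpha> = \<lbrakk>\<alpha>, \<phi> x\<rbrakk>\<^bsub>H\<^esub>"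
    and \<omega>: "\<And>x y. x \<in> carrier G \<Longrightarrow> y \<in> carrier G \<Longrightarrow> \<omega>1 x y \<ominus>\<^bsub>H\<^esub> \<omega>2 x y =
      l2 x (\<phi> y) \<oplus>\<^bsub>H\<^esub> r2 y (\<phi> x) \<oplus>\<^bsub>H\<^esub> \<lbrakk>\<phi> x, \<phi> y\<rbrakk>\<^bsub>H\<^esub> \<ominus>\<^bsub>H\<^esub> \<phi> \<lbrakk>x, y\<rbrakk>\<^bsub>G\<^esub>"
    using assms(1) by (auto simp: cocycle_rel_def ad_left_def ad_right_def)
  have closed [simp]: "\<And>x \<alpha>. x \<in> carrier G \<Longrightarrow> \<alpha> \<in> carrier H \<Longrightarrow> l1 x \<alpha> \<in> carrier H"
    "\<And>x \<alpha>. x \<in> carrier G \<Longrightarrow> \<alpha> \<in> carrier H \<Longrightarrow> r1 x \<alpha> \<in> carrier H"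
    "\<And>x y. x \<in> carrier G \<Longrightarrow> y \<in> carrier G \<Longrightarrow> \<omega>1 x y \<in> carrier H"
    using cocycle by (auto simp: cocycles2_def lin_maps_def Pi_def)
  note \<phi>_simps [simp] = lin_maps_closed[OF \<phi>] lin_maps_add[OF \<phi>] lin_maps_smult[OF \<phi>]
  define \<tau> where "\<tau> x = \<sigma> x \<oplus>\<^bsub>E\<^esub> i (\<phi> x)" for x
  have l': "l1 x \<alpha> = \<lbrakk>\<phi> x, \<alpha>\<rbrakk>\<^bsub>H\<^esub> \<oplus>\<^bsub>H\<^esub> l2 x \<alpha>" and r': "r1 x \<alpha> = \<lbrakk>\<alpha>, \<phi> x\<rbrakk>\<^bsub>H\<^esub> \<oplus>\<^bsub>H\<^esub> r2 x \<alpha>"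
    if "x \<in> carrier G" "\<alpha> \<in> carrier H" for x \<alpha>
    using that l[of x \<alpha>] r[of x \<alpha>] by (simp_all add: S.H.M.minus_eq_iff)
  have \<omega>': "\<phi> \<lbrakk>x, y\<rbrakk>\<^bsub>G\<^esub> \<oplus>\<^bsub>H\<^esub> \<omega>1 x y =
      \<omega>2 x y \<oplus>\<^bsub>H\<^esub> l2 x (\<phi> y) \<oplus>\<^bsub>H\<^esub> r2 y (\<phi> x) \<oplus>\<^bsub>H\<^esub> \<lbrakk>\<phi> x, \<phi> y\<rbrakk>\<^bsub>H\<^esub>"
    if xy: "x \<in> carrier G" "y \<in> carrier G" for x y
    using \<omega>[OF xy] xy
    by (subst (asm) S.H.M.minus_eq_minus_iff) (simp_all add: S.H.M.a_ac)
  have "split_extension K G H E i p \<tau> l1 r1 \<omega>1"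
  proof
    show "\<tau> \<in> lin_maps K G E"
      by (rule lin_mapsI) (simp_all add: \<tau>_def S.E.M.a_ac S.E.smult_r_distr)
    show "\<lbrakk>\<tau> x, \<tau> y\<rbrakk>\<^bsub>E\<^esub> = \<tau> \<lbrakk>x, y\<rbrakk>\<^bsub>G\<^esub> \<oplus>\<^bsub>E\<^esub> i (\<omega>1 x y)" if "x \<in> carrier G" "y \<in> carrier G" for x y
    proof -
      have "\<lbrakk>\<tau> x, \<tau> y\<rbrakk>\<^bsub>E\<^esub> = \<sigma> \<lbrakk>x, y\<rbrakk>\<^bsub>G\<^esub> \<oplus>\<^bsub>E\<^esub> i (\<phi> \<lbrakk>x, y\<rbrakk>\<^bsub>G\<^esub> \<oplus>\<^bsub>H\<^esub> \<omega>1 x y)"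
        using that by (simp only: \<tau>_def S.element_bracket \<phi>_simps \<omega>')
      then show ?thesis using that by (simp add: \<tau>_def S.E.M.a_assoc)
    qed
  qed (use S.i_hom S.p_hom S.i_inj S.exact in
      \<open>simp_all add: \<tau>_def l' r' S.i_l S.i_r S.E.bracket_add_left S.E.bracket_add_right S.E.M.a_comm\<close>)
  then show thesis by (rule that)
qed

text \<open>
  The morphism \<open>\<theta>\<close> carries the splitting \<open>\<sigma>\<close> to the splitting \<open>\<theta> \<circ> \<sigma>\<close> and is compatible with
  the inclusions of \<open>H\<close>, so the same cochain is produced. Combined with
  \<open>split_extension_isomorphic\<close> this makes the isomorphism relation symmetric without
  an argument that \<open>\<theta>\<close> is bijective.
\<close>

lemma split_extension_transport:
  assumes "((E1, i1, p1), (E2, i2, p2)) \<in> extension_rel K G H"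
    and "split_extension K G H E2 i2 p2 \<sigma> l r \<omega>"
  obtains \<sigma>' where "split_extension K G H E1 i1 p1 \<sigma>' l r \<omega>"
proof -
  interpret S: split_extension K G H E2 i2 p2 \<sigma> l r \<omega> by fact
  obtain \<theta> where ext: "(E1, i1, p1) \<in> extensions K G H" and hom: "\<theta> \<in> leibniz_hom K E2 E1"
    and \<theta>_i [simp]: "\<And>\<alpha>. \<alpha> \<in> carrier H \<Longrightarrow> \<theta> (i2 \<alpha>) = i1 \<alpha>"
    and \<theta>_p [simp]: "\<And>e. e \<in> carrier E2 \<Longrightarrow> p1 (\<theta> e) = p2 e"
    using assms(1) by (auto simp: extension_rel_def)
  interpret E1: leibniz_algebra K E1 using ext by (simp add: extensions_def)
  have \<theta>: "\<theta> \<in> lin_maps K E2 E1" using hom by (simp add: leibniz_hom_def)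
  note \<theta>_simps [simp] = lin_maps_closed[OF \<theta>] lin_maps_add[OF \<theta>] lin_maps_smult[OF \<theta>]
  have \<theta>_bracket: "\<lbrakk>\<theta> e, \<theta> f\<rbrakk>\<^bsub>E1\<^esub> = \<theta> \<lbrakk>e, f\<rbrakk>\<^bsub>E2\<^esub>" if "e \<in> carrier E2" "f \<in> carrier E2" for e f
    using hom that by (auto simp: leibniz_hom_def)
  have "split_extension K G H E1 i1 p1 (\<theta> \<circ> \<sigma>) l r \<omega>"
  proof
    show "i1 \<in> leibniz_hom K H E1" "p1 \<in> leibniz_hom K E1 G" "inj_on i1 (carrier H)"
      "i1 ` carrier H = {e \<in> carrier E1. p1 e = \<zero>\<^bsub>G\<^esub>}"
      using ext by (simp_all add: extensions_def)
    show "\<theta> \<circ> \<sigma> \<in> lin_maps K G E1" by (rule lin_mapsI) simp_all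
  qed (simp_all add: \<theta>_bracket S.\<sigma>_bracket S.i_l S.i_r flip: \<theta>_i)
  then show thesis by (rule that)
qed

lemma extension_splits:
  assumes "(E, i, p) \<in> extensions K G H" "leibniz_algebra K G"
  obtains \<sigma> where "\<sigma> \<in> splittings K G (E, i, p)"
proof -
  interpret E: leibniz_algebra K E using assms by (simp add: extensions_def)
  interpret G: leibniz_algebra K G by fact
  have "\<exists>\<sigma> \<in> lin_maps K G E. \<forall>x\<in>carrier G. p (\<sigma> x) = x"
    using assms(1)
    by (intro surjective_lin_map_splits E.field_axioms E.module_axioms G.module_axioms)
      (auto simp: extensions_def leibniz_hom_def)
  then show thesis using that by (auto simp: splittings_def)
qed

text \<open>
  The elements whose preimages under \<open>i\<close> define \<open>(l, r, \<omega>)\<close> are killed by \<open>p\<close>; therefore they lie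
  in the range of \<open>i\<close>, and the inverse of \<open>i\<close> is applied to them only where it is meaningful.
\<close>

lemma splitting_cocycle_split_extension:
  assumes "leibniz_algebra K G" "leibniz_algebra K H"
    and X: "(E, i, p) \<in> extensions K G H" and \<sigma>: "\<sigma> \<in> splittings K G (E, i, p)"
    and c: "splitting_cocycle G H (E, i, p) \<sigma> = (l, r, \<omega>)"
  shows "split_extension K G H E i p \<sigma> l r \<omega>"
proof -
  interpret G: leibniz_algebra K G by fact
  interpret H: leibniz_algebra K H by fact
  interpret E: leibniz_algebra K E using X by (simp add: extensions_def)
  have i_hom: "i \<in> leibniz_hom K H E" and p_hom: "p \<in> leibniz_hom K E G"
    and exact: "i ` carrier H = {e \<in> carrier E. p e = \<zero>\<^bsub>G\<^esub>}"
    using X by (simp_all add: extensions_def)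
  have \<sigma>_lin: "\<sigma> \<in> lin_maps K G E" and p_\<sigma> [simp]: "\<And>x. x \<in> carrier G \<Longrightarrow> p (\<sigma> x) = x"
    using \<sigma> by (simp_all add: splittings_def)
  have i_lin: "i \<in> lin_maps K H E" and p_lin: "p \<in> lin_maps K E G"
    using i_hom p_hom by (simp_all add: leibniz_hom_def)
  have p_bracket: "p \<lbrakk>e, f\<rbrakk>\<^bsub>E\<^esub> = \<lbrakk>p e, p f\<rbrakk>\<^bsub>G\<^esub>" if "e \<in> carrier E" "f \<in> carrier E" for e f
    using p_hom that by (simp add: leibniz_hom_def)
  have p_i: "p (i \<alpha>) = \<zero>\<^bsub>G\<^esub>" if "\<alpha> \<in> carrier H" for \<alpha>
    using exact that by blast
  have zero_bracket: "\<lbrakk>x, \<zero>\<^bsub>G\<^esub>\<rbrakk>\<^bsub>G\<^esub> = \<zero>\<^bsub>G\<^esub>" "\<lbrakk>\<zero>\<^bsub>G\<^esub>, x\<rbrakk>\<^bsub>G\<^esub> = \<zero>\<^bsub>G\<^esub>" if "x \<in> carrier G" for x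
    using that G.bracket_smult_right[of "\<zero>\<^bsub>K\<^esub>" x "\<zero>\<^bsub>G\<^esub>"] G.bracket_smult_left[of "\<zero>\<^bsub>K\<^esub>" "\<zero>\<^bsub>G\<^esub>" x]
    by (simp_all add: G.bracket_closed)
  note simps [simp] = lin_maps_closed[OF \<sigma>_lin] lin_maps_closed[OF i_lin] lin_maps_closed[OF p_lin]
    E.bracket_closed G.bracket_closed p_bracket p_i zero_bracket
    lin_maps_minus[OF E.abelian_group_axioms G.abelian_group_axioms p_lin]
  let ?j = "inv_into (carrier H) i"
  have j: "?j e \<in> carrier H" "i (?j e) = e" if "e \<in> carrier E" "p e = \<zero>\<^bsub>G\<^esub>" for e
    using that exact inv_into_into[of e i "carrier H"] f_inv_into_f[of e i "carrier H"] by simp_all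
  have l: "l = (\<lambda>x \<beta>. ?j \<lbrakk>\<sigma> x, i \<beta>\<rbrakk>\<^bsub>E\<^esub>)" and r: "r = (\<lambda>y \<alpha>. ?j \<lbrakk>i \<alpha>, \<sigma> y\<rbrakk>\<^bsub>E\<^esub>)"
    and \<omega>: "\<omega> = (\<lambda>x y. ?j (\<lbrakk>\<sigma> x, \<sigma> y\<rbrakk>\<^bsub>E\<^esub> \<ominus>\<^bsub>E\<^esub> \<sigma> \<lbrakk>x, y\<rbrakk>\<^bsub>G\<^esub>))"
    using c by (simp_all add: splitting_cocycle_def)
  show ?thesis
  proof
    show "i \<in> leibniz_hom K H E" "p \<in> leibniz_hom K E G" "inj_on i (carrier H)"
      "i ` carrier H = {e \<in> carrier E. p e = \<zero>\<^bsub>G\<^esub>}"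
      using X by (simp_all add: extensions_def)
    fix x y assume "x \<in> carrier G" "y \<in> carrier G"
    then have "\<lbrakk>\<sigma> x, \<sigma> y\<rbrakk>\<^bsub>E\<^esub> \<ominus>\<^bsub>E\<^esub> \<sigma> \<lbrakk>x, y\<rbrakk>\<^bsub>G\<^esub> = i (\<omega> x y)" and "\<omega> x y \<in> carrier H"
      by (simp_all add: \<omega> j G.M.minus_eq G.M.r_neg)
    then show "\<lbrakk>\<sigma> x, \<sigma> y\<rbrakk>\<^bsub>E\<^esub> = \<sigma> \<lbrakk>x, y\<rbrakk>\<^bsub>G\<^esub> \<oplus>\<^bsub>E\<^esub> i (\<omega> x y)" "\<omega> x y \<in> carrier H"
      using \<open>x \<in> carrier G\<close> \<open>y \<in> carrier G\<close> by (simp_all add: E.M.minus_eq_iff E.M.a_comm)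
  qed (simp_all add: \<sigma>_lin l r j)
qed

section \<open>The extension defined by a cocycle\<close>

text \<open>
  The extension lives on \<open>G \<times> H\<close>, transported along \<open>u\<close> into the given type, with the bracket
  \<open>[(x, \<alpha>), (y, \<beta>)] = ([x, y], \<omega> x y + l x \<beta> + r y \<alpha> + [\<alpha>, \<beta>])\<close>. The \<open>H\<close>-component of the
  Leibniz identity for \<open>(x, \<alpha>), (y, \<beta>), (z, \<gamma>)\<close> splits into one identity for each way of taking the
  three entries from \<open>G\<close> or from \<open>H\<close>, and these are the cocycle and derivation conditions together
  with the Leibniz identity of \<open>H\<close>.
\<close>

lemma cocycle_split_extension:
  fixes u :: "'g \<times> 'h \<Rightarrow> 'e"
  assumes G: "leibniz_algebra K G" and H: "leibniz_algebra K H"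
    and u: "inj_on u (carrier G \<times> carrier H)"
    and cocycle: "(l, r, \<omega>) \<in> cocycles2 K G H"
  obtains E :: "('k, 'e) leibniz" and i p \<sigma> where "split_extension K G H E i p \<sigma> l r \<omega>"
proof -
  interpret G: leibniz_algebra K G by fact
  interpret H: leibniz_algebra K H by fact
  note [simp] = G.bracket_closed H.bracket_closed
  have l_der: "\<And>x. x \<in> carrier G \<Longrightarrow> l x \<in> Der_left K H"
    and l_lin: "\<And>\<alpha>. \<alpha> \<in> carrier H \<Longrightarrow> (\<lambda>x. l x \<alpha>) \<in> lin_maps K G H"
    and r_der: "\<And>x. x \<in> carrier G \<Longrightarrow> r x \<in> Der_right K H"
    and r_lin: "\<And>\<alpha>. \<alpha> \<in> carrier H \<Longrightarrow> (\<lambda>x. r x \<alpha>) \<in> lin_maps K G H"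
    and \<omega>_lin_right: "\<And>x. x \<in> carrier G \<Longrightarrow> (\<lambda>y. \<omega> x y) \<in> lin_maps K G H"
    and \<omega>_lin_left: "\<And>y. y \<in> carrier G \<Longrightarrow> (\<lambda>x. \<omega> x y) \<in> lin_maps K G H"
    using cocycle by (auto simp: cocycles2_def)
  have l_lin': "\<And>x. x \<in> carrier G \<Longrightarrow> l x \<in> lin_maps K H H"
    and r_lin': "\<And>x. x \<in> carrier G \<Longrightarrow> r x \<in> lin_maps K H H"
    using l_der r_der by (auto simp: Der_left_def Der_right_def)
  note lin_simps [simp] =
    lin_maps_closed[OF l_lin] lin_maps_add[OF l_lin] lin_maps_smult[OF l_lin]
    lin_maps_zero[OF G.abelian_group_axioms H.abelian_group_axioms l_lin]
    lin_maps_add[OF l_lin'] lin_maps_smult[OF l_lin']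
    lin_maps_zero[OF H.abelian_group_axioms H.abelian_group_axioms l_lin']
    lin_maps_closed[OF r_lin] lin_maps_add[OF r_lin] lin_maps_smult[OF r_lin]
    lin_maps_zero[OF G.abelian_group_axioms H.abelian_group_axioms r_lin]
    lin_maps_add[OF r_lin'] lin_maps_smult[OF r_lin']
    lin_maps_zero[OF H.abelian_group_axioms H.abelian_group_axioms r_lin']
    lin_maps_closed[OF \<omega>_lin_right] lin_maps_add[OF \<omega>_lin_right] lin_maps_smult[OF \<omega>_lin_right]
    lin_maps_zero[OF G.abelian_group_axioms H.abelian_group_axioms \<omega>_lin_right]
    lin_maps_add[OF \<omega>_lin_left] lin_maps_smult[OF \<omega>_lin_left]
    lin_maps_zero[OF G.abelian_group_axioms H.abelian_group_axioms \<omega>_lin_left]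
  have zero_bracket [simp]: "\<lbrakk>x, \<zero>\<^bsub>G\<^esub>\<rbrakk>\<^bsub>G\<^esub> = \<zero>\<^bsub>G\<^esub>" "\<lbrakk>\<zero>\<^bsub>G\<^esub>, x\<rbrakk>\<^bsub>G\<^esub> = \<zero>\<^bsub>G\<^esub>" if "x \<in> carrier G" for x
    using that G.bracket_smult_right[of "\<zero>\<^bsub>K\<^esub>" x "\<zero>\<^bsub>G\<^esub>"] G.bracket_smult_left[of "\<zero>\<^bsub>K\<^esub>" "\<zero>\<^bsub>G\<^esub>" x]
    by simp_all
  have zero_bracket' [simp]: "\<lbrakk>x, \<zero>\<^bsub>H\<^esub>\<rbrakk>\<^bsub>H\<^esub> = \<zero>\<^bsub>H\<^esub>" "\<lbrakk>\<zero>\<^bsub>H\<^esub>, x\<rbrakk>\<^bsub>H\<^esub> = \<zero>\<^bsub>H\<^esub>" if "x \<in> carrier H" for x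
    using that H.bracket_smult_right[of "\<zero>\<^bsub>K\<^esub>" x "\<zero>\<^bsub>H\<^esub>"] H.bracket_smult_left[of "\<zero>\<^bsub>K\<^esub>" "\<zero>\<^bsub>H\<^esub>" x]
    by simp_all

  define B where "B x \<alpha> y \<beta> = \<omega> x y \<oplus>\<^bsub>H\<^esub> l x \<beta> \<oplus>\<^bsub>H\<^esub> r y \<alpha> \<oplus>\<^bsub>H\<^esub> \<lbrakk>\<alpha>, \<beta>\<rbrakk>\<^bsub>H\<^esub>" for x \<alpha> y \<beta>
  have B_closed [simp]: "B x \<alpha> y \<beta> \<in> carrier H"
    if "x \<in> carrier G" "\<alpha> \<in> carrier H" "y \<in> carrier G" "\<beta> \<in> carrier H" for x \<alpha> y \<beta>
    using that by (simp add: B_def)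
  have B_leibniz: "B x \<alpha> \<lbrakk>y, z\<rbrakk>\<^bsub>G\<^esub> (B y \<beta> z \<gamma>) =
      B \<lbrakk>x, y\<rbrakk>\<^bsub>G\<^esub> (B x \<alpha> y \<beta>) z \<gamma> \<oplus>\<^bsub>H\<^esub> B y \<beta> \<lbrakk>x, z\<rbrakk>\<^bsub>G\<^esub> (B x \<alpha> z \<gamma>)"
    if c: "x \<in> carrier G" "y \<in> carrier G" "z \<in> carrier G"
      "\<alpha> \<in> carrier H" "\<beta> \<in> carrier H" "\<gamma> \<in> carrier H" for x y z \<alpha> \<beta> \<gamma>
  proof -
    (* Each of the following facts turns a group of terms from the left of the Leibniz identity, those
       of one choice of entries, into the corresponding terms on the right. *)
    have xyz: "l x (\<omega> y z) \<oplus>\<^bsub>H\<^esub> \<omega> x \<lbrakk>y, z\<rbrakk>\<^bsub>G\<^esub> =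
        \<omega> \<lbrakk>x, y\<rbrakk>\<^bsub>G\<^esub> z \<oplus>\<^bsub>H\<^esub> \<omega> y \<lbrakk>x, z\<rbrakk>\<^bsub>G\<^esub> \<oplus>\<^bsub>H\<^esub> (l y (\<omega> x z) \<oplus>\<^bsub>H\<^esub> r z (\<omega> x y))"
    proof -
      have "l x (\<omega> y z) \<ominus>\<^bsub>H\<^esub> l y (\<omega> x z) \<ominus>\<^bsub>H\<^esub> r z (\<omega> x y) =
        \<omega> \<lbrakk>x, y\<rbrakk>\<^bsub>G\<^esub> z \<ominus>\<^bsub>H\<^esub> \<omega> x \<lbrakk>y, z\<rbrakk>\<^bsub>G\<^esub> \<oplus>\<^bsub>H\<^esub> \<omega> y \<lbrakk>x, z\<rbrakk>\<^bsub>G\<^esub>"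
        using cocycle c by (auto simp: cocycles2_def)
      then show ?thesis using c by (subst (asm) H.M.minus_minus_eq_minus_add_iff) simp_all
    qed
    have ll: "l x (l y \<gamma>) = \<lbrakk>\<omega> x y, \<gamma>\<rbrakk>\<^bsub>H\<^esub> \<oplus>\<^bsub>H\<^esub> l \<lbrakk>x, y\<rbrakk>\<^bsub>G\<^esub> \<gamma> \<oplus>\<^bsub>H\<^esub> l y (l x \<gamma>)"
    proof -
      have "l x (l y \<gamma>) \<ominus>\<^bsub>H\<^esub> l y (l x \<gamma>) \<ominus>\<^bsub>H\<^esub> l \<lbrakk>x, y\<rbrakk>\<^bsub>G\<^esub> \<gamma> = \<lbrakk>\<omega> x y, \<gamma>\<rbrakk>\<^bsub>H\<^esub>"
        using cocycle c by (auto simp: cocycles2_def commutator_def ad_left_def)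
      then show ?thesis using c by (simp add: H.M.minus_eq_iff)
    qed
    have lr: "l a (r b \<delta>) = \<lbrakk>\<delta>, \<omega> a b\<rbrakk>\<^bsub>H\<^esub> \<oplus>\<^bsub>H\<^esub> r \<lbrakk>a, b\<rbrakk>\<^bsub>G\<^esub> \<delta> \<oplus>\<^bsub>H\<^esub> r b (l a \<delta>)"
      if "a \<in> carrier G" "b \<in> carrier G" "\<delta> \<in> carrier H" for a b \<delta>
    proof -
      have "l a (r b \<delta>) \<ominus>\<^bsub>H\<^esub> r b (l a \<delta>) \<ominus>\<^bsub>H\<^esub> r \<lbrakk>a, b\<rbrakk>\<^bsub>G\<^esub> \<delta> = \<lbrakk>\<delta>, \<omega> a b\<rbrakk>\<^bsub>H\<^esub>"
        using cocycle that by (auto simp: cocycles2_def commutator_def ad_right_def)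
      then show ?thesis using that by (simp add: H.M.minus_eq_iff)
    qed
    (* The entries alpha, y, z: the condition on [l, r] would give - r z (l y alpha) in place of
       r z (r y alpha); the vanishing of r z (r y alpha + l y alpha) exchanges the two. *)
    have rr: "\<lbrakk>\<alpha>, \<omega> y z\<rbrakk>\<^bsub>H\<^esub> \<oplus>\<^bsub>H\<^esub> r \<lbrakk>y, z\<rbrakk>\<^bsub>G\<^esub> \<alpha> = r z (r y \<alpha>) \<oplus>\<^bsub>H\<^esub> l y (r z \<alpha>)"
    proof -
      have "r z (r y \<alpha> \<oplus>\<^bsub>H\<^esub> l y \<alpha>) = \<zero>\<^bsub>H\<^esub>" using cocycle c by (auto simp: cocycles2_def)
      then have "r z (l y \<alpha>) \<oplus>\<^bsub>H\<^esub> r z (r y \<alpha>) = \<zero>\<^bsub>H\<^esub>" using c by (simp add: H.M.a_comm)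
      then show ?thesis using c by (simp add: lr H.M.a_assoc H.M.a_comm[of "r z (r y \<alpha>)"])
    qed
    have l\<beta>\<gamma>: "l x \<lbrakk>\<beta>, \<gamma>\<rbrakk>\<^bsub>H\<^esub> = \<lbrakk>l x \<beta>, \<gamma>\<rbrakk>\<^bsub>H\<^esub> \<oplus>\<^bsub>H\<^esub> \<lbrakk>\<beta>, l x \<gamma>\<rbrakk>\<^bsub>H\<^esub>"
      using l_der c by (auto simp: Der_left_def)
    have \<alpha>l\<gamma>: "\<lbrakk>\<alpha>, l y \<gamma>\<rbrakk>\<^bsub>H\<^esub> = \<lbrakk>r y \<alpha>, \<gamma>\<rbrakk>\<^bsub>H\<^esub> \<oplus>\<^bsub>H\<^esub> l y \<lbrakk>\<alpha>, \<gamma>\<rbrakk>\<^bsub>H\<^esub>"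
    proof -
      have "\<lbrakk>l y \<alpha> \<oplus>\<^bsub>H\<^esub> r y \<alpha>, \<gamma>\<rbrakk>\<^bsub>H\<^esub> = \<zero>\<^bsub>H\<^esub>" using cocycle c by (auto simp: cocycles2_def)
      then have "\<lbrakk>r y \<alpha>, \<gamma>\<rbrakk>\<^bsub>H\<^esub> \<oplus>\<^bsub>H\<^esub> \<lbrakk>l y \<alpha>, \<gamma>\<rbrakk>\<^bsub>H\<^esub> = \<zero>\<^bsub>H\<^esub>"
        using c by (simp add: H.bracket_add_left H.M.a_comm)
      moreover have "l y \<lbrakk>\<alpha>, \<gamma>\<rbrakk>\<^bsub>H\<^esub> = \<lbrakk>l y \<alpha>, \<gamma>\<rbrakk>\<^bsub>H\<^esub> \<oplus>\<^bsub>H\<^esub> \<lbrakk>\<alpha>, l y \<gamma>\<rbrakk>\<^bsub>H\<^esub>"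
        using l_der c by (auto simp: Der_left_def)
      ultimately show ?thesis using c by (simp flip: H.M.a_assoc)
    qed
    have \<alpha>r\<beta>: "\<lbrakk>\<alpha>, r z \<beta>\<rbrakk>\<^bsub>H\<^esub> = r z \<lbrakk>\<alpha>, \<beta>\<rbrakk>\<^bsub>H\<^esub> \<oplus>\<^bsub>H\<^esub> \<lbrakk>\<beta>, r z \<alpha>\<rbrakk>\<^bsub>H\<^esub>"
    proof -
      have "\<lbrakk>\<alpha>, r z \<beta>\<rbrakk>\<^bsub>H\<^esub> \<ominus>\<^bsub>H\<^esub> \<lbrakk>\<beta>, r z \<alpha>\<rbrakk>\<^bsub>H\<^esub> = r z \<lbrakk>\<alpha>, \<beta>\<rbrakk>\<^bsub>H\<^esub>"
        using r_der c by (auto simp: Der_right_def)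
      then show ?thesis using c by (simp add: H.M.minus_eq_iff)
    qed
    have "B x \<alpha> \<lbrakk>y, z\<rbrakk>\<^bsub>G\<^esub> (B y \<beta> z \<gamma>) =
        (l x (\<omega> y z) \<oplus>\<^bsub>H\<^esub> \<omega> x \<lbrakk>y, z\<rbrakk>\<^bsub>G\<^esub>) \<oplus>\<^bsub>H\<^esub> l x (l y \<gamma>) \<oplus>\<^bsub>H\<^esub> l x (r z \<beta>) \<oplus>\<^bsub>H\<^esub>
        (\<lbrakk>\<alpha>, \<omega> y z\<rbrakk>\<^bsub>H\<^esub> \<oplus>\<^bsub>H\<^esub> r \<lbrakk>y, z\<rbrakk>\<^bsub>G\<^esub> \<alpha>) \<oplus>\<^bsub>H\<^esub> l x \<lbrakk>\<beta>, \<gamma>\<rbrakk>\<^bsub>H\<^esub> \<oplus>\<^bsub>H\<^esub>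
        \<lbrakk>\<alpha>, l y \<gamma>\<rbrakk>\<^bsub>H\<^esub> \<oplus>\<^bsub>H\<^esub> \<lbrakk>\<alpha>, r z \<beta>\<rbrakk>\<^bsub>H\<^esub> \<oplus>\<^bsub>H\<^esub> \<lbrakk>\<alpha>, \<lbrakk>\<beta>, \<gamma>\<rbrakk>\<^bsub>H\<^esub>\<rbrakk>\<^bsub>H\<^esub>"
      using c by (simp add: B_def H.bracket_add_right H.M.a_ac)
    also have "\<dots> = B \<lbrakk>x, y\<rbrakk>\<^bsub>G\<^esub> (B x \<alpha> y \<beta>) z \<gamma> \<oplus>\<^bsub>H\<^esub> B y \<beta> \<lbrakk>x, z\<rbrakk>\<^bsub>G\<^esub> (B x \<alpha> z \<gamma>)"
      unfolding xyz ll lr[OF c(1) c(3) c(5)] rr l\<beta>\<gamma> \<alpha>l\<gamma> \<alpha>r\<beta> H.leibniz_identity[OF c(4) c(5) c(6)]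
      using c by (simp add: B_def H.bracket_add_right H.bracket_add_left H.M.a_ac)
    finally show ?thesis .
  qed

  (* The inverse of u gives the coordinates of an element in G and H. *)
  define v where "v = inv_into (carrier G \<times> carrier H) u"
  have v [simp]: "v (u (x, \<alpha>)) = (x, \<alpha>)" if "x \<in> carrier G" "\<alpha> \<in> carrier H" for x \<alpha>
    unfolding v_def using u that by (intro inv_into_f_f) auto
  define E :: "('k, 'e) leibniz" where "E = \<lparr>carrier = u ` (carrier G \<times> carrier H),
    mult = undefined, one = undefined, zero = u (\<zero>\<^bsub>G\<^esub>, \<zero>\<^bsub>H\<^esub>),
    add = (\<lambda>e f. u (fst (v e) \<oplus>\<^bsub>G\<^esub> fst (v f), snd (v e) \<oplus>\<^bsub>H\<^esub> snd (v f))),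
    smult = (\<lambda>a e. u (a \<odot>\<^bsub>G\<^esub> fst (v e), a \<odot>\<^bsub>H\<^esub> snd (v e))),
    bracket = (\<lambda>e f. u (\<lbrakk>fst (v e), fst (v f)\<rbrakk>\<^bsub>G\<^esub>, B (fst (v e)) (snd (v e)) (fst (v f)) (snd (v f))))\<rparr>"
  have E_cases: "(\<And>x \<alpha>. x \<in> carrier G \<Longrightarrow> \<alpha> \<in> carrier H \<Longrightarrow> e = u (x, \<alpha>) \<Longrightarrow> P) \<Longrightarrow> P"
    if "e \<in> carrier E" for e P
    using that by (auto simp: E_def)
  have E_simps [simp]: "x \<in> carrier G \<Longrightarrow> \<alpha> \<in> carrier H \<Longrightarrow> u (x, \<alpha>) \<in> carrier E"
    "\<zero>\<^bsub>E\<^esub> = u (\<zero>\<^bsub>G\<^esub>, \<zero>\<^bsub>H\<^esub>)"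
    "\<lbrakk>x \<in> carrier G; \<alpha> \<in> carrier H; y \<in> carrier G; \<beta> \<in> carrier H\<rbrakk> \<Longrightarrow>
      u (x, \<alpha>) \<oplus>\<^bsub>E\<^esub> u (y, \<beta>) = u (x \<oplus>\<^bsub>G\<^esub> y, \<alpha> \<oplus>\<^bsub>H\<^esub> \<beta>)"
    "\<lbrakk>x \<in> carrier G; \<alpha> \<in> carrier H; y \<in> carrier G; \<beta> \<in> carrier H\<rbrakk> \<Longrightarrow>
      \<lbrakk>u (x, \<alpha>), u (y, \<beta>)\<rbrakk>\<^bsub>E\<^esub> = u (\<lbrakk>x, y\<rbrakk>\<^bsub>G\<^esub>, B x \<alpha> y \<beta>)"
    "\<lbrakk>x \<in> carrier G; \<alpha> \<in> carrier H\<rbrakk> \<Longrightarrow> a \<odot>\<^bsub>E\<^esub> u (x, \<alpha>) = u (a \<odot>\<^bsub>G\<^esub> x, a \<odot>\<^bsub>H\<^esub> \<alpha>)" for x \<alpha> y \<beta> a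
    by (simp_all add: E_def)
  have "abelian_group E"
  proof (rule abelian_groupI)
    fix e assume "e \<in> carrier E"
    then show "\<exists>f\<in>carrier E. f \<oplus>\<^bsub>E\<^esub> e = \<zero>\<^bsub>E\<^esub>"
    proof (rule E_cases)
      fix x \<alpha> assume "x \<in> carrier G" "\<alpha> \<in> carrier H" "e = u (x, \<alpha>)"
      then show ?thesis
        by (intro bexI[of _ "u (\<ominus>\<^bsub>G\<^esub> x, \<ominus>\<^bsub>H\<^esub> \<alpha>)"]) (simp_all add: G.M.l_neg H.M.l_neg)
    qed
  qed (auto elim!: E_cases simp: G.M.a_ac H.M.a_ac)
  then have module: "module K E"
    by (intro moduleI G.is_cring)
      (auto elim!: E_cases simp: G.smult_l_distr H.smult_l_distr G.smult_r_distr H.smult_r_distr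
        G.smult_assoc1 H.smult_assoc1)
  have leibniz: "\<lbrakk>e, \<lbrakk>f, g\<rbrakk>\<^bsub>E\<^esub>\<rbrakk>\<^bsub>E\<^esub> = \<lbrakk>\<lbrakk>e, f\<rbrakk>\<^bsub>E\<^esub>, g\<rbrakk>\<^bsub>E\<^esub> \<oplus>\<^bsub>E\<^esub> \<lbrakk>f, \<lbrakk>e, g\<rbrakk>\<^bsub>E\<^esub>\<rbrakk>\<^bsub>E\<^esub>"
    if "e \<in> carrier E" "f \<in> carrier E" "g \<in> carrier E" for e f g
  proof -
    obtain x \<alpha> y \<beta> z \<gamma> where c: "x \<in> carrier G" "y \<in> carrier G" "z \<in> carrier G"
      "\<alpha> \<in> carrier H" "\<beta> \<in> carrier H" "\<gamma> \<in> carrier H"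
      and e: "e = u (x, \<alpha>)" "f = u (y, \<beta>)" "g = u (z, \<gamma>)"
      using \<open>e \<in> carrier E\<close> \<open>f \<in> carrier E\<close> \<open>g \<in> carrier E\<close> by (metis E_cases)
    show ?thesis
      unfolding e using c by (simp add: B_leibniz[OF c] G.leibniz_identity[OF c(1-3)])
  qed
  have "leibniz_algebra K E"
    by (intro leibniz_algebra.intro leibniz_algebra_axioms.intro G.field_axioms module leibniz)
      (auto elim!: E_cases simp: G.bracket_add_left G.bracket_add_right G.bracket_smult_left
        G.bracket_smult_right B_def H.bracket_add_left H.bracket_add_right H.bracket_smult_left
        H.bracket_smult_right H.smult_r_distr H.M.a_ac)
  then interpret E: leibniz_algebra K E .
  have "split_extension K G H E (\<lambda>\<alpha>. u (\<zero>\<^bsub>G\<^esub>, \<alpha>)) (\<lambda>e. fst (v e)) (\<lambda>x. u (x, \<zero>\<^bsub>H\<^esub>)) l r \<omega>"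
  proof
    show "(\<lambda>\<alpha>. u (\<zero>\<^bsub>G\<^esub>, \<alpha>)) \<in> leibniz_hom K H E"
      by (auto simp: leibniz_hom_def B_def intro!: lin_mapsI)
    show "(\<lambda>e. fst (v e)) \<in> leibniz_hom K E G"
      by (auto simp: leibniz_hom_def intro!: lin_mapsI elim!: E_cases)
    show "inj_on (\<lambda>\<alpha>. u (\<zero>\<^bsub>G\<^esub>, \<alpha>)) (carrier H)"
      using u by (auto simp: inj_on_def)
    show "(\<lambda>\<alpha>. u (\<zero>\<^bsub>G\<^esub>, \<alpha>)) ` carrier H = {e \<in> carrier E. fst (v e) = \<zero>\<^bsub>G\<^esub>}"
      by (auto elim!: E_cases)
    show "(\<lambda>x. u (x, \<zero>\<^bsub>H\<^esub>)) \<in> lin_maps K G E"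
      by (rule lin_mapsI) simp_all
  qed (simp_all add: B_def)
  then show thesis by (rule that)
qed

section \<open>Classification\<close>

text \<open>
  The splitting is quantified away: the classification only needs to know which cocycles an extension
  can produce.
\<close>

definition realizes ::
    "('k, 'm) ring_scheme \<Rightarrow> ('k, 'g, 'n) leibniz_scheme \<Rightarrow> ('k, 'h, 'q) leibniz_scheme
     \<Rightarrow> ('k, 'g, 'h, 'e) extension \<Rightarrow> ('g, 'h) cochain \<Rightarrow> bool" where
  "realizes K G H = (\<lambda>(E, i, p) (l, r, \<omega>). \<exists>\<sigma>. split_extension K G H E i p \<sigma> l r \<omega>)"

lemma realizes_in_extensions: "realizes K G H X c \<Longrightarrow> X \<in> extensions K G H"
  unfolding realizes_def by (auto dest: split_extension.extension)

lemma realizes_in_cocycles: "realizes K G H X c \<Longrightarrow> c \<in> cocycles2 K G H"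
  unfolding realizes_def by (auto dest: split_extension.cocycle)

lemma realizes_isomorphic:
  "realizes K G H X c \<Longrightarrow> realizes K G H Y c \<Longrightarrow> (X, Y) \<in> extension_rel K G H"
  unfolding realizes_def by (auto intro: split_extension_isomorphic)

lemma realizes_equivalent:
  "realizes K G H X c \<Longrightarrow> realizes K G H X d \<Longrightarrow> (c, d) \<in> cocycle_rel K G H"
  unfolding realizes_def by (auto intro: splittings_cocycle_rel)

lemma realizes_extension_rel:
  assumes "(X, Y) \<in> extension_rel K G H" "realizes K G H Y c"
  shows "realizes K G H X c"
  using assms unfolding realizes_def
  by (cases X; cases Y; cases c) (auto elim: split_extension_transport)

lemma realizes_cocycle_rel:
  assumes "(c, d) \<in> cocycle_rel K G H" "realizes K G H X d"
  shows "realizes K G H X c"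
  using assms unfolding realizes_def
  by (cases X; cases c; cases d) (auto elim: equivalent_cocycle_splitting)

lemma realizes_splitting_cocycle:
  assumes "leibniz_algebra K G" "leibniz_algebra K H" "X \<in> extensions K G H"
    "\<sigma> \<in> splittings K G X"
  shows "realizes K G H X (splitting_cocycle G H X \<sigma>)"
proof -
  obtain E i p where X: "X = (E, i, p)" by (cases X)
  obtain l r \<omega> where c: "splitting_cocycle G H X \<sigma> = (l, r, \<omega>)" by (cases "splitting_cocycle G H X \<sigma>")
  have "split_extension K G H E i p \<sigma> l r \<omega>"
    using splitting_cocycle_split_extension assms c unfolding X by metis
  then show ?thesis unfolding c by (auto simp: realizes_def X)
qed

lemma cocycle_realized:
  fixes u :: "'g \<times> 'h \<Rightarrow> 'e"
  assumes "leibniz_algebra K G" "leibniz_algebra K H" "inj_on u (carrier G \<times> carrier H)"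
    and "c \<in> cocycles2 K G H"
  obtains X :: "('k, 'g, 'h, 'e) extension" where "realizes K G H X c"
proof -
  obtain l r \<omega> where c: "c = (l, r, \<omega>)" by (cases c)
  obtain E :: "('k, 'e) leibniz" and i p \<sigma> where "split_extension K G H E i p \<sigma> l r \<omega>"
    using cocycle_split_extension assms unfolding c by metis
  then show thesis using that[of "(E, i, p)"] by (auto simp: realizes_def c)
qed

(* The carrier of an extension of G by H is in bijection with carrier G \<times> carrier H. The
   assumption on u says that the type 'e, in which the carriers of the extensions live, has room
   for such a set; it holds for instance for 'e = 'g \<times> 'h. Any two extensions, on whatever
   types, can be moved to a common type of this kind. *)
theorem theorem2p8:
  fixes K :: "('k, 'm) ring_scheme"
    and G :: "('k, 'g, 'n) leibniz_scheme"
    and H :: "('k, 'h, 'p) leibniz_scheme"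
    and u :: "'g \<times> 'h \<Rightarrow> 'e"
  assumes "leibniz_algebra K G"
    and "leibniz_algebra K H"
    and "inj_on u (carrier G \<times> carrier H)"
  shows "equiv (cocycles2 K G H) (cocycle_rel K G H) \<and>
    equiv (extensions K G H :: ('k, 'g, 'h, 'e) extension set) (extension_rel K G H) \<and>
    (\<exists>\<Phi>. (\<forall>X \<in> (extensions K G H :: ('k, 'g, 'h, 'e) extension set).
             splittings K G X \<noteq> {} \<and>
             (\<forall>\<sigma> \<in> splittings K G X.
                splitting_cocycle G H X \<sigma> \<in> cocycles2 K G H \<and>
                \<Phi> (extension_rel K G H `` {X}) = cocycle_rel K G H `` {splitting_cocycle G H X \<sigma>})) \<and>
          bij_betw \<Phi> ((extensions K G H :: ('k, 'g, 'h, 'e) extension set) // extension_rel K G H)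
            (cohomology2 K G H))"
proof -
  let ?Z = "cocycles2 K G H" and ?Zrel = "cocycle_rel K G H"
  let ?X = "extensions K G H :: ('k, 'g, 'h, 'e) extension set"
  let ?Xrel = "extension_rel K G H :: (('k, 'g, 'h, 'e) extension \<times> _) set"
  let ?R = "realizes K G H :: ('k, 'g, 'h, 'e) extension \<Rightarrow> _"
  note splitting = realizes_splitting_cocycle[OF assms(1,2)]
  note realized = cocycle_realized[OF assms]
  have splits: "splittings K G X \<noteq> {}" if "X \<in> ?X" for X
    using that extension_splits[OF _ assms(1)] by (cases X) blast
  have realizing: "\<exists>c. ?R X c" if "X \<in> ?X" for X
    using splits[OF that] splitting[OF that] by blast
  have Z_sub: "?Zrel \<subseteq> ?Z \<times> ?Z" by (auto simp: cocycle_rel_def)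
  have X_sub: "?Xrel \<subseteq> ?X \<times> ?X" by (auto simp: extension_rel_def)
  have Z_equiv: "equiv ?Z ?Zrel"
  proof (rule equivI[OF Z_sub])
    show "refl_on ?Z ?Zrel"
      using realized realizes_equivalent by (metis refl_onI)
    show "sym ?Zrel"
    proof (rule symI)
      fix c d assume cd: "(c, d) \<in> ?Zrel"
      then obtain X where "?R X d" using Z_sub realized by blast
      with cd show "(d, c) \<in> ?Zrel" by (meson realizes_cocycle_rel realizes_equivalent)
    qed
    show "trans ?Zrel"
    proof (rule transI)
      fix b c d assume bcd: "(b, c) \<in> ?Zrel" "(c, d) \<in> ?Zrel"
      then obtain X where "?R X d" using Z_sub realized by blast
      with bcd show "(b, d) \<in> ?Zrel" by (meson realizes_cocycle_rel realizes_equivalent)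
    qed
  qed
  have X_equiv: "equiv ?X ?Xrel"
  proof (rule equivI[OF X_sub])
    show "refl_on ?X ?Xrel"
      using realizing realizes_isomorphic by (metis refl_onI)
    show "sym ?Xrel"
    proof (rule symI)
      fix X Y assume XY: "(X, Y) \<in> ?Xrel"
      then obtain c where "?R Y c" using X_sub realizing by blast
      with XY show "(Y, X) \<in> ?Xrel" by (meson realizes_extension_rel realizes_isomorphic)
    qed
    show "trans ?Xrel"
    proof (rule transI)
      fix X Y Z assume XYZ: "(X, Y) \<in> ?Xrel" "(Y, Z) \<in> ?Xrel"
      then obtain c where "?R Z c" using X_sub realizing by blast
      with XYZ show "(X, Z) \<in> ?Xrel" by (meson realizes_extension_rel realizes_isomorphic)
    qed
  qed
  (* The class of X is sent to the set of all cocycles realized by members of the class. This needs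
     no choice of representatives, and it equals a cohomology class as soon as one realized
     cocycle is known. *)
  define \<Phi> where "\<Phi> \<X> = {c. \<exists>X\<in>\<X>. ?R X c}" for \<X>
  have \<Phi>_realizes: "c \<in> \<Phi> (?Xrel `` {X}) \<longleftrightarrow> ?R X c" if "X \<in> ?X" for X c
    using equiv_class_self[OF X_equiv that] realizes_extension_rel unfolding \<Phi>_def by blast
  have \<Phi>: "\<Phi> (?Xrel `` {X}) = ?Zrel `` {c}" if "?R X c" for X c
  proof -
    have "d \<in> \<Phi> (?Xrel `` {X}) \<longleftrightarrow> (c, d) \<in> ?Zrel" for d
      using \<Phi>_realizes[OF realizes_in_extensions[OF that], of d] that realizes_equivalent
        realizes_cocycle_rel Z_equiv by (metis equivE symD)
    then show ?thesis by blast
  qed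
  have "bij_betw \<Phi> (?X // ?Xrel) (cohomology2 K G H)"
    unfolding bij_betw_def cohomology2_def
  proof
    show "inj_on \<Phi> (?X // ?Xrel)"
    proof (rule inj_onI, elim quotientE)
      fix \<X> \<Y> X Y
      assume eq: "\<Phi> \<X> = \<Phi> \<Y>" and X: "X \<in> ?X" "\<X> = ?Xrel `` {X}" and Y: "Y \<in> ?X" "\<Y> = ?Xrel `` {Y}"
      obtain c where "?R X c" using realizing X by blast
      moreover from this have "?R Y c" using eq X Y \<Phi>_realizes by blast
      ultimately show "\<X> = \<Y>"
        using X Y equiv_class_eq[OF X_equiv] realizes_isomorphic by metis
    qed
    show "\<Phi> ` (?X // ?Xrel) = ?Z // ?Zrel"
    proof
      show "\<Phi> ` (?X // ?Xrel) \<subseteq> ?Z // ?Zrel"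
      proof (clarify, elim quotientE)
        fix \<X> X assume X: "X \<in> ?X" "\<X> = ?Xrel `` {X}"
        then obtain c where "?R X c" using realizing by blast
        then show "\<Phi> \<X> \<in> ?Z // ?Zrel" unfolding X using \<Phi> realizes_in_cocycles by (metis quotientI)
      qed
      show "?Z // ?Zrel \<subseteq> \<Phi> ` (?X // ?Xrel)"
      proof (rule subsetI, elim quotientE)
        fix \<C> c assume c: "c \<in> ?Z" "\<C> = ?Zrel `` {c}"
        then obtain X where X: "?R X c" using realized by blast
        then have "\<C> = \<Phi> (?Xrel `` {X})" using \<Phi> c by simp
        then show "\<C> \<in> \<Phi> ` (?X // ?Xrel)"
          using X realizes_in_extensions by (metis imageI quotientI)
      qed
    qed
  qed
  moreover have "splitting_cocycle G H X \<sigma> \<in> ?Z"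
    "\<Phi> (?Xrel `` {X}) = ?Zrel `` {splitting_cocycle G H X \<sigma>}"
    if "X \<in> ?X" "\<sigma> \<in> splittings K G X" for X \<sigma>
    using splitting[OF that] realizes_in_cocycles \<Phi> by blast+
  ultimately show ?thesis
    using Z_equiv X_equiv splits by (intro conjI exI[of _ \<Phi>] ballI) simp_all
qed

end
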